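(* Let $n\ge 1$ and let $u\in H^2_{loc}(\mathbb{R}^n)$ be defined by $u(x)=\frac12 x_n^2$ if $x_n>0$ and $u(x)=0$ if $x_n\le 0$, where $x=(x_1,\dots,x_n)$. Then $u$ minimizes $\mathcal{F}$ globally.
   Context: For $\Omega\subset\mathbb{R}^n$ open and bounded and $u\in H^2(\Omega)$, the two-sided biharmonic Alt-Caffarelli functional is $\mathcal{F}(u,\Omega):=\int_\Omega(\Delta u)^2\,\mathrm{d}x+|\{x\in\Omega:u(x)\neq 0\}|$, where $|\cdot|$ is Lebesgue measure. A function $u\in H^2_{loc}(\mathbb{R}^n)$ minimizes $\mathcal{F}$ globally (is a global minimizer of $\mathcal{F}$) if for all bounded open sets $\Omega\subset\mathbb{R}^n$ and all $v\in H^2(\Omega)$ with $v-u\in H^2_0(\Omega)$ one has $\mathcal{F}(u,\Omega)\le\mathcal{F}(v,\Omega)$. Here $H^2_0(\Omega)$ is the closure of $C_0^\infty(\Omega)$ in $H^2(\Omega)$. *)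

theory Defs
  imports "HOL-Analysis.Analysis"
begin

text \<open>
  Elements of \<open>L\<^sup>2(\<Omega>)\<close> and of the Sobolev spaces are represented by total functions; only their
  values on \<open>\<Omega>\<close>, up to null sets, matter. Derivatives of order \<open>m\<close> are indexed by lists of \<open>m\<close>
  coordinate indices instead of multi-indices.
\<close>

definition partial_deriv :: "'n::finite \<Rightarrow> (real^'n \<Rightarrow> real) \<Rightarrow> real^'n \<Rightarrow> real" where
  "partial_deriv i f x = frechet_derivative f (at x) (axis i 1)"

definition iter_partial :: "'n::finite list \<Rightarrow> (real^'n \<Rightarrow> real) \<Rightarrow> real^'n \<Rightarrow> real" where
  "iter_partial \<alpha> f = foldr partial_deriv \<alpha> f"

text \<open>
  Differentiability of the iterated partial derivatives of every order also makes all of them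
  continuous, so this is \<open>C\<^sup>\<infinity>(\<real>\<^sup>n)\<close>.
\<close>

definition smooth :: "(real^'n::finite \<Rightarrow> real) \<Rightarrow> bool" where
  "smooth f \<longleftrightarrow> (\<forall>\<alpha>. iter_partial \<alpha> f differentiable_on UNIV)"

definition test_functions :: "(real^'n::finite) set \<Rightarrow> (real^'n \<Rightarrow> real) set" where
  "test_functions \<Omega> =
     {\<phi>. smooth \<phi> \<and> compact (closure {x. \<phi> x \<noteq> 0}) \<and> closure {x. \<phi> x \<noteq> 0} \<subseteq> \<Omega>}"

definition L2_space :: "(real^'n::finite) set \<Rightarrow> (real^'n \<Rightarrow> real) set" where
  "L2_space \<Omega> =
     {f. f \<in> borel_measurable (lebesgue_on \<Omega>) \<and> integrable (lebesgue_on \<Omega>) (\<lambda>x. (f x)\<^sup>2)}"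

definition is_weak_deriv ::
  "(real^'n::finite) set \<Rightarrow> 'n list \<Rightarrow> (real^'n \<Rightarrow> real) \<Rightarrow> (real^'n \<Rightarrow> real) \<Rightarrow> bool" where
  "is_weak_deriv \<Omega> \<alpha> u g \<longleftrightarrow>
     (\<forall>\<phi>\<in>test_functions \<Omega>.
        (\<integral>x. u x * iter_partial \<alpha> \<phi> x \<partial>lebesgue_on \<Omega>) =
        (-1) ^ length \<alpha> * (\<integral>x. g x * \<phi> x \<partial>lebesgue_on \<Omega>))"

definition sobolev_H :: "nat \<Rightarrow> (real^'n::finite) set \<Rightarrow> (real^'n \<Rightarrow> real) set" where
  "sobolev_H m \<Omega> =
     {u \<in> L2_space \<Omega>. \<forall>\<alpha>. length \<alpha> \<le> m \<longrightarrow> (\<exists>g\<in>L2_space \<Omega>. is_weak_deriv \<Omega> \<alpha> u g)}"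

text \<open>
  A choice of the weak derivative, meaningful when it exists in \<open>L\<^sup>2(\<Omega>)\<close>; it is then determined
  almost everywhere on \<open>\<Omega>\<close>.
\<close>

definition weak_deriv ::
  "(real^'n::finite) set \<Rightarrow> 'n list \<Rightarrow> (real^'n \<Rightarrow> real) \<Rightarrow> real^'n \<Rightarrow> real" where
  "weak_deriv \<Omega> \<alpha> u = (SOME g. g \<in> L2_space \<Omega> \<and> is_weak_deriv \<Omega> \<alpha> u g)"

definition weak_laplacian ::
  "(real^'n::finite) set \<Rightarrow> (real^'n \<Rightarrow> real) \<Rightarrow> real^'n \<Rightarrow> real" where
  "weak_laplacian \<Omega> u x = (\<Sum>i\<in>UNIV. weak_deriv \<Omega> [i, i] u x)"

text \<open>
  For \<open>m = 2\<close> the squared norm is the integral of \<open>u\<^sup>2 + |\<nabla>u|\<^sup>2 + |D\<^sup>2u|\<^sup>2\<close> with the Frobenius norm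
  of the Hessian: mixed derivatives occur once for each ordering of their indices.
\<close>

definition sobolev_norm :: "nat \<Rightarrow> (real^'n::finite) set \<Rightarrow> (real^'n \<Rightarrow> real) \<Rightarrow> real" where
  "sobolev_norm m \<Omega> u =
     sqrt (\<Sum>\<alpha> | length \<alpha> \<le> m. \<integral>x. (weak_deriv \<Omega> \<alpha> u x)\<^sup>2 \<partial>lebesgue_on \<Omega>)"

definition sobolev_H0 :: "nat \<Rightarrow> (real^'n::finite) set \<Rightarrow> (real^'n \<Rightarrow> real) set" where
  "sobolev_H0 m \<Omega> =
     {w \<in> sobolev_H m \<Omega>.
        \<forall>\<epsilon>>0. \<exists>\<phi>\<in>test_functions \<Omega>. sobolev_norm m \<Omega> (\<lambda>x. w x - \<phi> x) < \<epsilon>}"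

definition sobolev_H_loc :: "nat \<Rightarrow> (real^'n::finite \<Rightarrow> real) set" where
  "sobolev_H_loc m = {u. \<forall>\<Omega>. open \<Omega> \<and> bounded \<Omega> \<longrightarrow> u \<in> sobolev_H m \<Omega>}"

definition biharmonic_AC :: "(real^'n::finite \<Rightarrow> real) \<Rightarrow> (real^'n) set \<Rightarrow> real" where
  "biharmonic_AC u \<Omega> =
     (\<integral>x. (weak_laplacian \<Omega> u x)\<^sup>2 \<partial>lebesgue_on \<Omega>) + measure lebesgue {x \<in> \<Omega>. u x \<noteq> 0}"

definition global_minimizer :: "(real^'n::finite \<Rightarrow> real) \<Rightarrow> bool" where
  "global_minimizer u \<longleftrightarrow>
     u \<in> sobolev_H_loc 2 \<and>
     (\<forall>\<Omega> v. open \<Omega> \<and> bounded \<Omega> \<and> v \<in> sobolev_H 2 \<Omega> \<and>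
        (\<lambda>x. v x - u x) \<in> sobolev_H0 2 \<Omega> \<longrightarrow> biharmonic_AC u \<Omega> \<le> biharmonic_AC v \<Omega>)"

end

theory Submission imports Defs begin

text \<open>
  Write \<open>u\<close> for the half-space profile; it is \<open>C\<^sup>1\<close> with Lipschitz derivatives, and \<open>\<Delta> u\<close> is the
  indicator of \<open>{x\<^sub>k > 0} = {u \<noteq> 0}\<close>. So its energy on \<open>\<Omega>\<close> is \<open>2 \<integral>\<^sub>\<Omega> \<Delta> u\<close>. Let \<open>v\<close> be a competitor. Two
  facts give the minimality of \<open>u\<close>.

  \<^item> \<open>\<Delta> v = 0\<close> almost everywhere on \<open>{v = 0}\<close>, since weak derivatives vanish almost everywhere on
    the zero set of their function (\<open>derivative_zero_on_zero_set\<close>, applied to \<open>v\<close> and then to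
    \<open>\<partial>\<^sub>i v\<close>). Where \<open>v \<noteq> 0\<close>, the inequality \<open>(\<Delta> v - 1)\<^sup>2 \<ge> 0\<close> reads \<open>(\<Delta> v)\<^sup>2 + 1 \<ge> 2 \<Delta> v\<close>. So almost
    everywhere the energy density of \<open>v\<close> is at least \<open>2 \<Delta> v\<close>.
  \<^item> \<open>\<integral>\<^sub>\<Omega> \<Delta> v = \<integral>\<^sub>\<Omega> \<Delta> u\<close>: the difference \<open>v - u\<close> is an \<open>H\<^sup>2\<close> limit of test functions \<open>\<phi>\<close>, and
    \<open>\<integral> \<partial>\<^sub>i\<partial>\<^sub>i \<phi> = 0\<close>.

  Equality holds for \<open>u\<close> because \<open>\<Delta> u\<close> takes only the values \<open>0\<close> and \<open>1\<close>, and \<open>\<Delta> u = 1\<close> exactly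
  where \<open>u \<noteq> 0\<close>.

  That a derivative vanishes on the zero set usually rests on the chain rule for Sobolev functions,
  hence on mollification. Here the hypothesis on \<open>v - u\<close> already supplies the approximation:
  \<open>u + \<phi>\<close> converges to \<open>v\<close> together with the derivatives in question. It suffices to integrate by
  parts for functions that are locally Lipschitz in one direction (\<open>integration_by_parts\<close>), a class
  that contains \<open>u\<close>, \<open>\<partial>\<^sub>i u\<close>, the test functions, and their sums and compositions with \<open>C\<^sup>1\<close>
  contractions; the result passes to the limit (\<open>weak_chain_rule\<close>).

  Since the weak derivatives that enter the energy and the Sobolev norm are chosen arbitrarily, their
  uniqueness almost everywhere is needed throughout. It follows from the fundamental lemma of the
  calculus of variations (\<open>AE_zero_if_test_integrals_zero\<close>), for which explicit smooth functions
  approximating the indicators of boxes are built from \<open>exp (- c / t)\<close>.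
\<close>

section \<open>Square-integrable functions on a bounded open set\<close>

lemma eq_0_if_arbitrarily_small:
  fixes d N :: real
  assumes N: "0 \<le> N" and small: "\<And>\<epsilon>. \<epsilon> > 0 \<Longrightarrow> \<bar>d\<bar> \<le> \<epsilon> * N"
  shows "d = 0"
proof (rule ccontr)
  assume "d \<noteq> 0"
  then have "\<bar>d\<bar> \<le> \<bar>d\<bar> / (2 * (N + 1)) * N" using N by (intro small) simp
  also have "\<dots> \<le> \<bar>d\<bar> / (2 * (N + 1)) * (N + 1)"
    using N by (intro mult_left_mono) auto
  also have "\<dots> = \<bar>d\<bar> / 2" using N by (simp add: field_simps)
  finally show False using \<open>d \<noteq> 0\<close> by simp
qed

locale bounded_open_set =
  fixes \<Omega> :: "(real^'n::finite) set"
  assumes open_\<Omega>: "open \<Omega>" and bounded_\<Omega>: "bounded \<Omega>"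
begin

lemma lmeasurable_\<Omega>: "\<Omega> \<in> lmeasurable"
  using open_\<Omega> bounded_\<Omega> by (simp add: lmeasurable_open)

lemma sets_\<Omega> [measurable, simp]: "\<Omega> \<in> sets lebesgue"
  using lmeasurable_\<Omega> by blast

sublocale finite_measure "lebesgue_on \<Omega>"
  using lmeasurable_\<Omega> by (rule finite_measure_lebesgue_on)

lemma integrable_bounded:
  assumes "f \<in> borel_measurable (lebesgue_on \<Omega>)" and "\<And>x. x \<in> \<Omega> \<Longrightarrow> \<bar>f x :: real\<bar> \<le> B"
  shows "integrable (lebesgue_on \<Omega>) f"
  using assms by (intro integrable_const_bound[where B = B]) auto

lemma L2_measurable: "f \<in> L2_space \<Omega> \<Longrightarrow> f \<in> borel_measurable (lebesgue_on \<Omega>)"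
  by (simp add: L2_space_def)

lemma L2_bounded:
  assumes f: "f \<in> borel_measurable (lebesgue_on \<Omega>)" and B: "\<And>x. x \<in> \<Omega> \<Longrightarrow> \<bar>f x\<bar> \<le> B"
  shows "f \<in> L2_space \<Omega>"
proof -
  have "(f x)\<^sup>2 \<le> B\<^sup>2" if "x \<in> \<Omega>" for x
    using power_mono[OF B[OF that], of 2] by simp
  then have "integrable (lebesgue_on \<Omega>) (\<lambda>x. (f x)\<^sup>2)"
    using f by (intro integrable_bounded[where B = "B\<^sup>2"]) auto
  then show ?thesis using f by (simp add: L2_space_def)
qed

lemma L2_mult_integrable:
  assumes f: "f \<in> L2_space \<Omega>" and g: "g \<in> L2_space \<Omega>"
  shows "integrable (lebesgue_on \<Omega>) (\<lambda>x. f x * g x)"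
proof (rule Bochner_Integration.integrable_bound)
  show "integrable (lebesgue_on \<Omega>) (\<lambda>x. (f x)\<^sup>2 + (g x)\<^sup>2)"
    using f g by (auto simp: L2_space_def)
  show "(\<lambda>x. f x * g x) \<in> borel_measurable (lebesgue_on \<Omega>)"
    using f g by (auto simp: L2_space_def)
  have "\<bar>f x * g x\<bar> \<le> (f x)\<^sup>2 + (g x)\<^sup>2" for x
    using sum_squares_bound[of "\<bar>f x\<bar>" "\<bar>g x\<bar>"] mult_nonneg_nonneg[of "\<bar>f x\<bar>" "\<bar>g x\<bar>"]
    by (simp only: abs_mult power2_abs) linarith
  then show "AE x in lebesgue_on \<Omega>. norm (f x * g x) \<le> norm ((f x)\<^sup>2 + (g x)\<^sup>2)"
    by (intro AE_I2) simp
qed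

lemma L2_bounded_mult:
  assumes f: "f \<in> borel_measurable (lebesgue_on \<Omega>)" "\<And>x. \<bar>f x\<bar> \<le> C" and g: "g \<in> L2_space \<Omega>"
  shows "(\<lambda>x. f x * g x) \<in> L2_space \<Omega>"
proof -
  have "integrable (lebesgue_on \<Omega>) (\<lambda>x. (f x * g x)\<^sup>2)"
  proof (rule Bochner_Integration.integrable_bound)
    show "integrable (lebesgue_on \<Omega>) (\<lambda>x. C\<^sup>2 * (g x)\<^sup>2)"
      using g by (simp add: L2_space_def)
    have "(f x)\<^sup>2 \<le> C\<^sup>2" for x
      using power_mono[OF f(2)[of x], of 2] by simp
    then have "(f x * g x)\<^sup>2 \<le> C\<^sup>2 * (g x)\<^sup>2" for x
      by (simp add: power_mult_distrib mult_right_mono)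
    then show "AE x in lebesgue_on \<Omega>. norm ((f x * g x)\<^sup>2) \<le> norm (C\<^sup>2 * (g x)\<^sup>2)"
      by (intro AE_I2) simp
  qed (use f L2_measurable[OF g] in simp)
  then show ?thesis using f L2_measurable[OF g] by (simp add: L2_space_def)
qed

lemma L2_integrable: "f \<in> L2_space \<Omega> \<Longrightarrow> integrable (lebesgue_on \<Omega>) f"
  using L2_mult_integrable[OF _ L2_bounded[of "\<lambda>_. 1" 1]] by simp

lemma L2_cmult: "f \<in> L2_space \<Omega> \<Longrightarrow> (\<lambda>x. c * f x) \<in> L2_space \<Omega>"
  by (auto simp: L2_space_def power_mult_distrib)

lemma L2_add:
  assumes f: "f \<in> L2_space \<Omega>" and g: "g \<in> L2_space \<Omega>"
  shows "(\<lambda>x. f x + g x) \<in> L2_space \<Omega>"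
  using assms L2_mult_integrable[OF assms]
  by (auto simp: L2_space_def power2_sum mult.assoc)

lemma L2_diff:
  "f \<in> L2_space \<Omega> \<Longrightarrow> g \<in> L2_space \<Omega> \<Longrightarrow> (\<lambda>x. f x - g x) \<in> L2_space \<Omega>"
  using L2_add[of f "\<lambda>x. -1 * g x"] L2_cmult[of g "-1"] by simp

lemma L2_sum:
  "(\<And>i. i \<in> I \<Longrightarrow> f i \<in> L2_space \<Omega>) \<Longrightarrow> (\<lambda>x. \<Sum>i\<in>I. f i x) \<in> L2_space \<Omega>"
proof (induction I rule: infinite_finite_induct)
  case (insert i I)
  then show ?case by (simp add: L2_add)
qed (simp_all add: L2_space_def)

definition L2_norm :: "(real^'n \<Rightarrow> real) \<Rightarrow> real" where
  "L2_norm f = sqrt (\<integral>x. (f x)\<^sup>2 \<partial>lebesgue_on \<Omega>)"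

lemma L2_norm_nonneg: "0 \<le> L2_norm f"
  by (simp add: L2_norm_def)

text \<open>
  The quadratic polynomial \<open>\<integral> (t \<bar>f\<bar> - \<bar>g\<bar>)\<^sup>2\<close> in \<open>t\<close> is nonnegative, so its discriminant is not positive.
\<close>

lemma L2_Cauchy_Schwarz:
  assumes f: "f \<in> L2_space \<Omega>" and g: "g \<in> L2_space \<Omega>"
  shows "(\<integral>x. \<bar>f x * g x\<bar> \<partial>lebesgue_on \<Omega>) \<le> L2_norm f * L2_norm g"
proof -
  define a b c where "a = (\<integral>x. (f x)\<^sup>2 \<partial>lebesgue_on \<Omega>)" and "b = (\<integral>x. (g x)\<^sup>2 \<partial>lebesgue_on \<Omega>)"
    and "c = (\<integral>x. \<bar>f x * g x\<bar> \<partial>lebesgue_on \<Omega>)"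
  have quad: "0 \<le> t\<^sup>2 * a - 2 * t * c + b" for t
  proof -
    have "0 \<le> (\<integral>x. (t * \<bar>f x\<bar> - \<bar>g x\<bar>)\<^sup>2 \<partial>lebesgue_on \<Omega>)" by simp
    also have "\<dots> = (\<integral>x. t\<^sup>2 * (f x)\<^sup>2 - 2 * t * \<bar>f x * g x\<bar> + (g x)\<^sup>2 \<partial>lebesgue_on \<Omega>)"
      by (intro Bochner_Integration.integral_cong)
        (auto simp: power2_diff power_mult_distrib abs_mult)
    also have "\<dots> = t\<^sup>2 * a - 2 * t * c + b"
      using f g L2_mult_integrable[OF f g] by (simp add: L2_space_def a_def b_def c_def)
    finally show ?thesis .
  qed
  have "0 \<le> a" "0 \<le> b" "0 \<le> c" by (auto simp: a_def b_def c_def)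
  have "c\<^sup>2 \<le> a * b"
  proof (cases "a = 0")
    case True
    have "c = 0"
    proof (rule ccontr)
      assume "c \<noteq> 0"
      then show False using quad[of "(b + 1) / (2 * c)"] True by simp
    qed
    then show ?thesis using True by simp
  next
    case False
    then have "0 < a" using \<open>0 \<le> a\<close> by simp
    have "0 \<le> a * ((c / a)\<^sup>2 * a - 2 * (c / a) * c + b)"
      using quad[of "c / a"] \<open>0 < a\<close> by simp
    also have "\<dots> = a * b - c\<^sup>2"
      using \<open>0 < a\<close> by (simp add: field_simps power2_eq_square)
    finally show ?thesis by simp
  qed
  then have "c \<le> sqrt (a * b)" using real_le_rsqrt by blast
  then show ?thesis by (simp add: a_def b_def c_def L2_norm_def real_sqrt_mult)
qed

text \<open>
  Cauchy--Schwarz for an integrand that is only dominated by a product; all error terms below have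
  this form.
\<close>

lemma integral_mult_le_L2:
  assumes "integrable (lebesgue_on \<Omega>) h" "f \<in> L2_space \<Omega>" "g \<in> L2_space \<Omega>"
    and "\<And>x. \<bar>h x\<bar> \<le> \<bar>f x * g x\<bar>"
  shows "\<bar>\<integral>x. h x \<partial>lebesgue_on \<Omega>\<bar> \<le> L2_norm f * L2_norm g"
proof -
  have "\<bar>\<integral>x. h x \<partial>lebesgue_on \<Omega>\<bar> \<le> (\<integral>x. \<bar>h x\<bar> \<partial>lebesgue_on \<Omega>)"
    using integral_norm_bound[of "lebesgue_on \<Omega>" h] by simp
  also have "\<dots> \<le> (\<integral>x. \<bar>f x * g x\<bar> \<partial>lebesgue_on \<Omega>)"
    using assms L2_mult_integrable[OF assms(2,3)] by (intro integral_mono) auto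
  also have "\<dots> \<le> L2_norm f * L2_norm g"
    by (rule L2_Cauchy_Schwarz[OF assms(2,3)])
  finally show ?thesis .
qed

lemma L2_norm_cong_AE:
  assumes "f \<in> L2_space \<Omega>" "g \<in> L2_space \<Omega>" "AE x in lebesgue_on \<Omega>. f x = g x"
  shows "L2_norm f = L2_norm g"
  unfolding L2_norm_def using assms
  by (intro arg_cong[where f = sqrt] integral_cong_AE) (auto simp: L2_space_def)

end

section \<open>Test functions\<close>

lemma iter_partial_simps [simp]:
  "iter_partial [] f = f"
  "iter_partial (i # \<alpha>) f = partial_deriv i (iter_partial \<alpha> f)"
  by (simp_all add: iter_partial_def)

lemma iter_partial_append: "iter_partial (\<alpha> @ \<beta>) f = iter_partial \<alpha> (iter_partial \<beta> f)"
  by (simp add: iter_partial_def)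

lemma smooth_partial_deriv: "smooth f \<Longrightarrow> smooth (partial_deriv i f)"
  unfolding smooth_def by (metis iter_partial_append iter_partial_simps)

lemma smooth_differentiable: "smooth f \<Longrightarrow> f differentiable at x"
  unfolding smooth_def differentiable_on_def by (metis UNIV_I iter_partial_simps(1))

lemma smooth_continuous: "smooth f \<Longrightarrow> continuous_on UNIV f"
  unfolding smooth_def by (metis differentiable_imp_continuous_on iter_partial_simps(1))

lemma has_partial_derivative:
  assumes "f differentiable at (x + s *\<^sub>R axis i 1)"
  shows "((\<lambda>t. f (x + t *\<^sub>R axis i 1)) has_real_derivative partial_deriv i f (x + s *\<^sub>R axis i 1)) (at s)"
proof -
  let ?D = "frechet_derivative f (at (x + s *\<^sub>R axis i 1))"
  have f: "(f has_derivative ?D) (at (x + s *\<^sub>R axis i 1))"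
    using assms by (simp add: frechet_derivative_works)
  then have lin: "linear ?D" by (rule has_derivative_linear)
  have "((\<lambda>t. f (x + t *\<^sub>R axis i 1)) has_derivative (\<lambda>t. ?D (t *\<^sub>R axis i 1))) (at s)"
    by (rule has_derivative_compose[where f = "\<lambda>t. x + t *\<^sub>R axis i 1"
          and f' = "\<lambda>t. t *\<^sub>R axis i 1", OF _ f]) (auto intro!: derivative_eq_intros)
  moreover have "(\<lambda>t. ?D (t *\<^sub>R axis i 1)) = (*) (partial_deriv i f (x + s *\<^sub>R axis i 1))"
    by (simp add: linear_cmul[OF lin] partial_deriv_def fun_eq_iff)
  ultimately show ?thesis by (simp add: has_field_derivative_def)
qed

lemma partial_deriv_eq_0:
  assumes "x \<notin> closure {x. f x \<noteq> 0}"
  shows "partial_deriv i f x = 0"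
proof -
  have "(f has_derivative (\<lambda>_. 0)) (at x)"
    by (rule has_derivative_transform_within_open[where f = "\<lambda>_. 0" and s = "- closure {x. f x \<noteq> 0}"])
      (use assms closure_subset[of "{x. f x \<noteq> 0}"] in auto)
  then have "frechet_derivative f (at x) = (\<lambda>_. 0)" by (rule frechet_derivative_at[symmetric])
  then show ?thesis by (simp add: partial_deriv_def)
qed

text \<open>
  Outside the closure of \<open>{\<phi> \<noteq> 0}\<close> the function vanishes on an open set, so differentiation does
  not enlarge supports.
\<close>

lemma test_partial_deriv:
  assumes "\<phi> \<in> test_functions \<Omega>"
  shows "partial_deriv i \<phi> \<in> test_functions \<Omega>"
proof -
  have sub: "closure {x. partial_deriv i \<phi> x \<noteq> 0} \<subseteq> closure {x. \<phi> x \<noteq> 0}"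
    by (rule closure_minimal) (use partial_deriv_eq_0 in \<open>auto\<close>)
  then have "compact (closure {x. partial_deriv i \<phi> x \<noteq> 0})"
    using assms unfolding test_functions_def
    by (metis (mono_tags, lifting) closed_closure compact_Int_closed inf.absorb_iff2 mem_Collect_eq)
  then show ?thesis using assms sub smooth_partial_deriv by (auto simp: test_functions_def)
qed

lemma test_iter_partial:
  "\<phi> \<in> test_functions \<Omega> \<Longrightarrow> iter_partial \<alpha> \<phi> \<in> test_functions \<Omega>"
  by (induction \<alpha>) (auto intro: test_partial_deriv)

lemma test_continuous: "\<phi> \<in> test_functions \<Omega> \<Longrightarrow> continuous_on UNIV \<phi>"
  by (simp add: test_functions_def smooth_continuous)

lemma test_measurable: "\<phi> \<in> test_functions \<Omega> \<Longrightarrow> \<phi> \<in> borel_measurable borel"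
  by (intro borel_measurable_continuous_onI test_continuous)

lemma test_eq_0: "\<phi> \<in> test_functions \<Omega> \<Longrightarrow> x \<notin> \<Omega> \<Longrightarrow> \<phi> x = 0"
  unfolding test_functions_def using closure_subset[of "{x. \<phi> x \<noteq> 0}"] by auto

lemma test_bounded:
  assumes "\<phi> \<in> test_functions \<Omega>"
  obtains B where "0 \<le> B" "\<And>x. \<bar>\<phi> x\<bar> \<le> B"
proof -
  let ?K = "closure {x. \<phi> x \<noteq> 0}"
  have "compact (\<phi> ` ?K)"
    using assms continuous_on_subset[OF test_continuous[OF assms] subset_UNIV]
    by (intro compact_continuous_image) (auto simp: test_functions_def)
  then obtain B where B: "\<And>x. x \<in> ?K \<Longrightarrow> \<bar>\<phi> x\<bar> \<le> B"
    using compact_imp_bounded by (force simp: bounded_iff)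
  have "\<bar>\<phi> x\<bar> \<le> max 0 B" for x
    using B[of x] closure_subset[of "{x. \<phi> x \<noteq> 0}"] by (cases "\<phi> x = 0") auto
  then show ?thesis using that[of "max 0 B"] by auto
qed

lemma test_support:
  assumes "\<phi> \<in> test_functions \<Omega>"
  obtains R where "0 \<le> R" "\<And>x. norm x > R \<Longrightarrow> \<phi> x = 0"
proof -
  have "bounded {x. \<phi> x \<noteq> 0}"
    using assms compact_imp_bounded[THEN bounded_subset, OF _ closure_subset]
    by (auto simp: test_functions_def)
  then obtain R where R: "\<And>x. \<phi> x \<noteq> 0 \<Longrightarrow> norm x \<le> R"
    by (auto simp: bounded_iff)
  show ?thesis by (rule that[of "max 0 R"]) (use R in force)+
qed

lemma (in bounded_open_set) test_L2:
  assumes "\<phi> \<in> test_functions \<Omega>"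
  shows "\<phi> \<in> L2_space \<Omega>"
proof -
  obtain B where "\<And>x. \<bar>\<phi> x\<bar> \<le> B" using test_bounded[OF assms] by blast
  then show ?thesis
    using test_measurable[OF assms]
    by (intro L2_bounded[where B = B]) (auto simp: measurable_completion measurable_restrict_space1)
qed

text \<open>
  Integrals against test functions can be taken over the whole space, where translation invariance
  is available.
\<close>

lemma (in bounded_open_set) integral_eq_lebesgue:
  assumes "\<And>x. x \<notin> \<Omega> \<Longrightarrow> f x = (0::real)"
  shows "(\<integral>x. f x \<partial>lebesgue_on \<Omega>) = (\<integral>x. f x \<partial>lebesgue)"
proof -
  have "(\<integral>x. f x \<partial>lebesgue_on \<Omega>) = (\<integral>x. (if x \<in> \<Omega> then f x else 0) \<partial>lebesgue)"
    by (rule Lebesgue_Measure.integral_restrict_UNIV[symmetric]) simp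
  also have "(\<lambda>x. if x \<in> \<Omega> then f x else 0) = f" using assms by auto
  finally show ?thesis .
qed

section \<open>Functions that are Lipschitz in one direction and integration by parts\<close>

text \<open>
  A class in which integration by parts needs neither Fubini's theorem nor mollification. The
  Lipschitz bound in direction \<open>i\<close> dominates the difference quotients, and their almost everywhere
  limit \<open>g\<close> may be discontinuous, as for \<open>max x\<^sub>k 0\<close>.
\<close>

definition lipschitz_partial ::
  "'n::finite \<Rightarrow> (real^'n \<Rightarrow> real) \<Rightarrow> (real^'n \<Rightarrow> real) \<Rightarrow> bool" where
  "lipschitz_partial i f g \<longleftrightarrow>
     continuous_on UNIV f \<and> g \<in> borel_measurable lebesgue \<and>
     (\<forall>R. \<exists>L. \<forall>x t. norm x \<le> R \<and> \<bar>t\<bar> \<le> 1 \<longrightarrow> \<bar>f (x + t *\<^sub>R axis i 1) - f x\<bar> \<le> L * \<bar>t\<bar>) \<and>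
     (AE x in lebesgue. ((\<lambda>t. f (x + t *\<^sub>R axis i 1)) has_real_derivative g x) (at 0))"

lemma lipschitz_partialD:
  assumes "lipschitz_partial i f g"
  shows "continuous_on UNIV f" "g \<in> borel_measurable lebesgue" "f \<in> borel_measurable borel"
    "\<exists>L\<ge>0. \<forall>x t. norm x \<le> R \<and> \<bar>t\<bar> \<le> 1 \<longrightarrow> \<bar>f (x + t *\<^sub>R axis i 1) - f x\<bar> \<le> L * \<bar>t\<bar>"
    "AE x in lebesgue. ((\<lambda>t. f (x + t *\<^sub>R axis i 1)) has_real_derivative g x) (at 0)"
proof -
  show "continuous_on UNIV f" "g \<in> borel_measurable lebesgue"
    "AE x in lebesgue. ((\<lambda>t. f (x + t *\<^sub>R axis i 1)) has_real_derivative g x) (at 0)"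
    using assms by (simp_all add: lipschitz_partial_def)
  then show "f \<in> borel_measurable borel" by (intro borel_measurable_continuous_onI)
  obtain L where L: "\<And>x t. norm x \<le> R \<and> \<bar>t\<bar> \<le> 1 \<Longrightarrow> \<bar>f (x + t *\<^sub>R axis i 1) - f x\<bar> \<le> L * \<bar>t\<bar>"
    using assms unfolding lipschitz_partial_def by metis
  have "\<bar>f (x + t *\<^sub>R axis i 1) - f x\<bar> \<le> \<bar>L\<bar> * \<bar>t\<bar>" if "norm x \<le> R \<and> \<bar>t\<bar> \<le> 1" for x t
    using L[OF that] mult_right_mono[OF abs_ge_self[of L] abs_ge_zero[of t]] by linarith
  then show "\<exists>L\<ge>0. \<forall>x t. norm x \<le> R \<and> \<bar>t\<bar> \<le> 1 \<longrightarrow> \<bar>f (x + t *\<^sub>R axis i 1) - f x\<bar> \<le> L * \<bar>t\<bar>"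
    by (intro exI[of _ "\<bar>L\<bar>"]) auto
qed

lemma lipschitz_partial_add:
  assumes f: "lipschitz_partial i f g" and f': "lipschitz_partial i f' g'"
  shows "lipschitz_partial i (\<lambda>x. f x + f' x) (\<lambda>x. g x + g' x)"
  unfolding lipschitz_partial_def
proof (intro conjI allI)
  note D = lipschitz_partialD[OF f] and D' = lipschitz_partialD[OF f']
  show "continuous_on UNIV (\<lambda>x. f x + f' x)" by (intro continuous_intros D D')
  show "(\<lambda>x. g x + g' x) \<in> borel_measurable lebesgue" by (intro borel_measurable_add D D')
  show "AE x in lebesgue. ((\<lambda>t. f (x + t *\<^sub>R axis i 1) + f' (x + t *\<^sub>R axis i 1))
          has_real_derivative g x + g' x) (at 0)"
    using D(5) D'(5) by eventually_elim (rule DERIV_add)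
  fix R
  obtain L where L: "\<And>x t. norm x \<le> R \<Longrightarrow> \<bar>t\<bar> \<le> 1 \<Longrightarrow> \<bar>f (x + t *\<^sub>R axis i 1) - f x\<bar> \<le> L * \<bar>t\<bar>"
    using D(4)[of R] by blast
  obtain L' where L': "\<And>x t. norm x \<le> R \<Longrightarrow> \<bar>t\<bar> \<le> 1 \<Longrightarrow> \<bar>f' (x + t *\<^sub>R axis i 1) - f' x\<bar> \<le> L' * \<bar>t\<bar>"
    using D'(4)[of R] by blast
  have "\<bar>f (x + t *\<^sub>R axis i 1) + f' (x + t *\<^sub>R axis i 1) - (f x + f' x)\<bar> \<le> (L + L') * \<bar>t\<bar>"
    if "norm x \<le> R" "\<bar>t\<bar> \<le> 1" for x t
    using L[OF that] L'[OF that] by (simp add: algebra_simps)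
  then show "\<exists>L. \<forall>x t. norm x \<le> R \<and> \<bar>t\<bar> \<le> 1 \<longrightarrow>
     \<bar>f (x + t *\<^sub>R axis i 1) + f' (x + t *\<^sub>R axis i 1) - (f x + f' x)\<bar> \<le> L * \<bar>t\<bar>"
    by blast
qed

text \<open>
  A function with derivative bounded by \<open>1\<close> is a contraction, so composing with it preserves the
  Lipschitz bounds.
\<close>

lemma lipschitz_partial_compose:
  assumes f: "lipschitz_partial i f g"
    and F: "\<And>t. (F has_real_derivative F' t) (at t)"
    and F': "\<And>t. \<bar>F' t\<bar> \<le> 1" "continuous_on UNIV F'"
  shows "lipschitz_partial i (\<lambda>x. F (f x)) (\<lambda>x. F' (f x) * g x)"
  unfolding lipschitz_partial_def
proof (intro conjI allI)
  note D = lipschitz_partialD[OF f]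
  have contF: "continuous_on UNIV F"
    using F by (intro DERIV_continuous_on) auto
  show "continuous_on UNIV (\<lambda>x. F (f x))"
    by (rule continuous_on_compose2[OF contF D(1)]) auto
  have "(\<lambda>x. F' (f x)) \<in> borel_measurable lebesgue"
    using continuous_on_compose2[OF F'(2) D(1)]
    by (intro measurable_completion) (auto intro: borel_measurable_continuous_onI)
  then show "(\<lambda>x. F' (f x) * g x) \<in> borel_measurable lebesgue"
    using D(2) by (intro borel_measurable_times)
  show "AE x in lebesgue. ((\<lambda>t. F (f (x + t *\<^sub>R axis i 1)))
          has_real_derivative F' (f x) * g x) (at 0)"
    using D(5)
  proof eventually_elim
    case (elim x)
    have "(F has_real_derivative F' (f x)) (at (f (x + 0 *\<^sub>R axis i 1)))" using F by simp
    then show ?case by (rule DERIV_chain2[OF _ elim])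
  qed
  fix R
  obtain L where L: "\<And>x t. norm x \<le> R \<Longrightarrow> \<bar>t\<bar> \<le> 1 \<Longrightarrow> \<bar>f (x + t *\<^sub>R axis i 1) - f x\<bar> \<le> L * \<bar>t\<bar>"
    using D(4)[of R] by blast
  have "\<bar>F r - F s\<bar> \<le> \<bar>r - s\<bar>" for r s
    using field_differentiable_bound[of UNIV F F' 1 r s] F F'(1) by auto
  then have "\<bar>F (f (x + t *\<^sub>R axis i 1)) - F (f x)\<bar> \<le> L * \<bar>t\<bar>" if "norm x \<le> R" "\<bar>t\<bar> \<le> 1" for x t
    using L[OF that] order_trans by blast
  then show "\<exists>L. \<forall>x t. norm x \<le> R \<and> \<bar>t\<bar> \<le> 1 \<longrightarrow>
     \<bar>F (f (x + t *\<^sub>R axis i 1)) - F (f x)\<bar> \<le> L * \<bar>t\<bar>"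
    by blast
qed

lemma test_lipschitz_partial:
  assumes \<phi>: "\<phi> \<in> test_functions \<Omega>"
  shows "lipschitz_partial i \<phi> (partial_deriv i \<phi>)"
  unfolding lipschitz_partial_def
proof (intro conjI allI)
  show "continuous_on UNIV \<phi>" by (rule test_continuous[OF \<phi>])
  show "partial_deriv i \<phi> \<in> borel_measurable lebesgue"
    using test_measurable[OF test_partial_deriv[OF \<phi>]] by (simp add: measurable_completion)
  have D: "((\<lambda>t. \<phi> (x + t *\<^sub>R axis i 1)) has_real_derivative partial_deriv i \<phi> (x + s *\<^sub>R axis i 1)) (at s)"
    for x s using \<phi> by (intro has_partial_derivative smooth_differentiable) (simp add: test_functions_def)
  show "AE x in lebesgue. ((\<lambda>t. \<phi> (x + t *\<^sub>R axis i 1)) has_real_derivative partial_deriv i \<phi> x) (at 0)"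
    using D[of _ 0] by simp
  obtain B where B: "\<And>x. \<bar>partial_deriv i \<phi> x\<bar> \<le> B"
    using test_bounded[OF test_partial_deriv[OF \<phi>]] by blast
  have "\<bar>\<phi> (x + t *\<^sub>R axis i 1) - \<phi> x\<bar> \<le> B * \<bar>t\<bar>" for x t
    using field_differentiable_bound[of UNIV "\<lambda>t. \<phi> (x + t *\<^sub>R axis i 1)"
        "\<lambda>t. partial_deriv i \<phi> (x + t *\<^sub>R axis i 1)" B t 0] D B by auto
  then show "\<exists>L. \<forall>x t. norm x \<le> R \<and> \<bar>t\<bar> \<le> 1 \<longrightarrow> \<bar>\<phi> (x + t *\<^sub>R axis i 1) - \<phi> x\<bar> \<le> L * \<bar>t\<bar>" for R
    by blast
qed

text \<open>
  Dominated convergence on the ball that carries \<open>q\<close>. Integration by parts uses this twice, once with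
  the quotients of \<open>f\<close> and once with those of the test function.
\<close>

lemma difference_quotient_integral_tendsto:
  assumes f: "lipschitz_partial i f g"
    and q: "q \<in> borel_measurable lebesgue" "\<And>x. \<bar>q x\<bar> \<le> B" "\<And>x. norm x > R \<Longrightarrow> q x = 0"
    and h: "h \<longlonglongrightarrow> 0" "\<And>n. h n \<noteq> 0" "\<And>n. \<bar>h n\<bar> \<le> 1"
  shows "(\<lambda>n. \<integral>x. (f (x + h n *\<^sub>R axis i 1) - f x) / h n * q x \<partial>lebesgue)
           \<longlonglongrightarrow> (\<integral>x. g x * q x \<partial>lebesgue)"
proof -
  note D = lipschitz_partialD[OF f]
  obtain L where L: "0 \<le> L" "\<And>x t. norm x \<le> R \<Longrightarrow> \<bar>t\<bar> \<le> 1 \<Longrightarrow> \<bar>f (x + t *\<^sub>R axis i 1) - f x\<bar> \<le> L * \<bar>t\<bar>"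
    using D(4)[of R] by blast
  have fm: "(\<lambda>x. f (x + c)) \<in> borel_measurable lebesgue" for c
    by (intro measurable_completion measurable_compose[OF _ D(3)]) simp_all
  show ?thesis
  proof (rule integral_dominated_convergence[where w = "\<lambda>x. L * B * indicator (cball 0 R) x"])
    show "(\<lambda>x. g x * q x) \<in> borel_measurable lebesgue" using D(2) q(1) by measurable
    show "(\<lambda>x. (f (x + h n *\<^sub>R axis i 1) - f x) / h n * q x) \<in> borel_measurable lebesgue" for n
      using fm[of "h n *\<^sub>R axis i 1"] fm[of 0] q(1) by simp
    show "integrable lebesgue (\<lambda>x. L * B * indicator (cball (0::real^'a) R) x)"
      using lmeasurable_cball[of "0::real^'a" R]
      by (intro integrable_mult_right integrable_real_indicator) (auto simp: fmeasurable_def)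
    show "AE x in lebesgue. (\<lambda>n. (f (x + h n *\<^sub>R axis i 1) - f x) / h n * q x) \<longlonglongrightarrow> g x * q x"
      using D(5)
    proof eventually_elim
      case (elim x)
      have "((\<lambda>t. (f (x + t *\<^sub>R axis i 1) - f x) / t) \<longlongrightarrow> g x) (at 0)"
        using elim by (simp add: has_field_derivative_iff)
      moreover have "filterlim h (at 0) sequentially"
        using h by (auto simp: filterlim_at)
      ultimately have "(\<lambda>n. (f (x + h n *\<^sub>R axis i 1) - f x) / h n) \<longlonglongrightarrow> g x"
        by (rule filterlim_compose)
      then show ?case by (intro tendsto_mult tendsto_const)
    qed
    show "AE x in lebesgue. norm ((f (x + h n *\<^sub>R axis i 1) - f x) / h n * q x)
            \<le> L * B * indicator (cball 0 R) x" for n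
    proof (intro AE_I2)
      fix x
      show "norm ((f (x + h n *\<^sub>R axis i 1) - f x) / h n * q x) \<le> L * B * indicator (cball 0 R) x"
      proof (cases "norm x \<le> R")
        case True
        have "\<bar>(f (x + h n *\<^sub>R axis i 1) - f x) / h n\<bar> \<le> L"
          using L(2)[OF True h(3)[of n]] h(2)[of n] by (simp add: abs_divide divide_le_eq)
        then have "\<bar>(f (x + h n *\<^sub>R axis i 1) - f x) / h n\<bar> * \<bar>q x\<bar> \<le> L * B"
          using L(1) q(2) by (intro mult_mono) auto
        then show ?thesis using True by (simp add: abs_mult)
      qed (use q(3) in auto)
    qed
  qed
qed

lemma integral_lebesgue_translation:
  fixes f :: "'a::euclidean_space \<Rightarrow> real"
  assumes "f \<in> borel_measurable borel"
  shows "(\<integral>x. f (x + c) \<partial>lebesgue) = (\<integral>x. f x \<partial>lebesgue)"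
proof -
  have "(\<integral>x. f x \<partial>lebesgue) = (\<integral>x. f x \<partial>distr lborel borel ((+) c))"
    using assms by (simp add: integral_completion lborel_distr_plus)
  also have "\<dots> = (\<integral>x. f (c + x) \<partial>lborel)"
    using assms by (intro integral_distr) auto
  also have "\<dots> = (\<integral>x. f (c + x) \<partial>lebesgue)"
    using assms by (intro integral_completion[symmetric]) simp
  finally show ?thesis by (simp add: add.commute)
qed

lemma integrable_bounded_support:
  fixes f :: "'a::euclidean_space \<Rightarrow> real"
  assumes "f \<in> borel_measurable lebesgue" "\<And>x. norm x \<le> R \<Longrightarrow> \<bar>f x\<bar> \<le> B" "\<And>x. norm x > R \<Longrightarrow> f x = 0"
  shows "integrable lebesgue f"
proof (rule Bochner_Integration.integrable_bound)
  show "integrable lebesgue (\<lambda>x. B * indicator (cball (0::'a) R) x)"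
    using lmeasurable_cball[of "0::'a" R]
    by (intro integrable_mult_right integrable_real_indicator) (auto simp: fmeasurable_def)
  have "\<bar>f x\<bar> \<le> \<bar>B * indicator (cball (0::'a) R) x\<bar>" for x
    using assms(2,3)[of x] by (cases "norm x \<le> R") auto
  then show "AE x in lebesgue. norm (f x) \<le> norm (B * indicator (cball (0::'a) R) x)"
    by (intro AE_I2) simp
qed fact

text \<open>
  By translation invariance a forward difference quotient of \<open>\<psi>\<close> integrated against \<open>f\<close> is minus the
  backward difference quotient of \<open>f\<close> integrated against \<open>\<psi>\<close>. Both sides converge as the step tends
  to \<open>0\<close>.
\<close>

proposition integration_by_parts:
  assumes f: "lipschitz_partial i f g" and \<psi>: "\<psi> \<in> test_functions \<Omega>"
  shows "(\<integral>x. f x * partial_deriv i \<psi> x \<partial>lebesgue) = - (\<integral>x. g x * \<psi> x \<partial>lebesgue)"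
proof -
  note D = lipschitz_partialD[OF f]
  define e :: "real^'a" where "e = axis i 1"
  have [simp]: "norm e = 1" by (simp add: e_def norm_axis_1)
  define h where "h n = 1 / real (Suc n)" for n
  have h: "h \<longlonglongrightarrow> 0" "\<And>n. h n \<noteq> 0" "\<And>n. \<bar>h n\<bar> \<le> 1"
    unfolding h_def using LIMSEQ_inverse_real_of_nat by (auto simp: inverse_eq_divide)
  obtain R where R: "0 \<le> R" "\<And>x. norm x > R \<Longrightarrow> \<psi> x = 0" using test_support[OF \<psi>] by blast
  obtain B where B: "0 \<le> B" "\<And>x. \<bar>\<psi> x\<bar> \<le> B" using test_bounded[OF \<psi>] by blast
  have "compact (f ` cball 0 (R + 1))"
    by (intro compact_continuous_image continuous_on_subset[OF D(1)]) auto
  then obtain C where C: "\<And>x. norm x \<le> R + 1 \<Longrightarrow> \<bar>f x\<bar> \<le> C"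
    using compact_imp_bounded by (force simp: bounded_iff)
  have "0 \<le> C" using C[of 0] R(1) by simp
  \<comment> \<open>Steps are at most \<open>1\<close>, so all quotients of \<open>\<psi>\<close> are supported in the ball of radius \<open>R + 1\<close>,
    and cutting \<open>f\<close> off there makes it bounded without changing the integrals.\<close>
  define q where "q x = indicator (cball 0 (R + 1)) x * f x" for x
  have fm: "f \<in> borel_measurable borel" and \<psi>m: "\<psi> \<in> borel_measurable borel"
    using D(3) test_measurable[OF \<psi>] by auto
  have tm [simp]: "(\<lambda>x. f (x + c)) \<in> borel_measurable borel" "(\<lambda>x. \<psi> (x + c)) \<in> borel_measurable borel"
    "(\<lambda>x. f (x - c)) \<in> borel_measurable borel" for c
    by (rule measurable_compose[OF _ fm] measurable_compose[OF _ \<psi>m]; simp)+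
  have qm: "q \<in> borel_measurable lebesgue"
    unfolding q_def using fm
    by (intro measurable_completion) (auto intro!: borel_measurable_times borel_measurable_indicator)
  have q: "\<bar>q x\<bar> \<le> C" for x using C[of x] \<open>0 \<le> C\<close> by (auto simp: q_def indicator_def)
  have supp: "\<psi> (x + h n *\<^sub>R e) = 0" if "norm x > R + 1" for x n
  proof -
    have "norm x \<le> norm (x + h n *\<^sub>R e) + norm (h n *\<^sub>R e)"
      using norm_triangle_ineq4[of "x + h n *\<^sub>R e" "h n *\<^sub>R e"] by simp
    then show ?thesis using R(2) that h(3)[of n] by simp
  qed
  have 1: "(\<lambda>n. \<integral>x. (\<psi> (x + h n *\<^sub>R e) - \<psi> x) / h n * q x \<partial>lebesgue)
           \<longlonglongrightarrow> (\<integral>x. partial_deriv i \<psi> x * q x \<partial>lebesgue)"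
    unfolding e_def
    by (rule difference_quotient_integral_tendsto[OF test_lipschitz_partial[OF \<psi>] qm q _ h, where R = "R + 1"])
      (simp add: q_def)
  have 2: "(\<lambda>n. \<integral>x. (f (x + (- h n) *\<^sub>R e) - f x) / (- h n) * \<psi> x \<partial>lebesgue)
           \<longlonglongrightarrow> (\<integral>x. g x * \<psi> x \<partial>lebesgue)"
    unfolding e_def
    by (rule difference_quotient_integral_tendsto[OF f _ B(2) R(2)])
      (use h \<psi>m in \<open>auto simp: measurable_completion tendsto_minus_cancel_left[symmetric]\<close>)
  have 3: "(\<integral>x. (\<psi> (x + h n *\<^sub>R e) - \<psi> x) / h n * q x \<partial>lebesgue)
      = - (\<integral>x. (f (x + (- h n) *\<^sub>R e) - f x) / (- h n) * \<psi> x \<partial>lebesgue)" for n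
  proof -
    have i1: "integrable lebesgue (\<lambda>x. f x * \<psi> x)"
      by (rule integrable_bounded_support[where R = "R + 1" and B = "C * B"])
        (use fm \<psi>m R C B \<open>0 \<le> C\<close> in \<open>auto simp: measurable_completion abs_mult intro!: mult_mono\<close>)
    have i2: "integrable lebesgue (\<lambda>x. f x * \<psi> (x + h n *\<^sub>R e))"
      by (rule integrable_bounded_support[where R = "R + 1" and B = "C * B"])
        (use fm \<psi>m R C B \<open>0 \<le> C\<close> supp in \<open>auto simp: measurable_completion abs_mult intro!: mult_mono\<close>)
    have i3: "integrable lebesgue (\<lambda>x. f (x - h n *\<^sub>R e) * \<psi> x)"
    proof (rule integrable_bounded_support[where R = R and B = "C * B"])
      fix x :: "real^'a" assume "norm x \<le> R"
      then have "norm (x - h n *\<^sub>R e) \<le> R + 1"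
        using norm_triangle_ineq4[of x "h n *\<^sub>R e"] h(3)[of n] by simp
      then show "\<bar>f (x - h n *\<^sub>R e) * \<psi> x\<bar> \<le> C * B"
        using C B \<open>0 \<le> C\<close> by (auto simp: abs_mult intro!: mult_mono)
    qed (use fm \<psi>m R in \<open>auto simp: measurable_completion\<close>)
    have tr: "(\<integral>x. f x * \<psi> (x + h n *\<^sub>R e) \<partial>lebesgue) = (\<integral>x. f (x - h n *\<^sub>R e) * \<psi> x \<partial>lebesgue)"
      using integral_lebesgue_translation[of "\<lambda>x. f (x - h n *\<^sub>R e) * \<psi> x" "h n *\<^sub>R e"] fm \<psi>m by simp
    have "(\<integral>x. (\<psi> (x + h n *\<^sub>R e) - \<psi> x) / h n * q x \<partial>lebesgue)
        = (\<integral>x. (f x * \<psi> (x + h n *\<^sub>R e) - f x * \<psi> x) / h n \<partial>lebesgue)"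
    proof (intro Bochner_Integration.integral_cong refl)
      fix x
      show "(\<psi> (x + h n *\<^sub>R e) - \<psi> x) / h n * q x = (f x * \<psi> (x + h n *\<^sub>R e) - f x * \<psi> x) / h n"
        using supp[of x n] R(2)[of x]
        by (cases "norm x > R + 1") (auto simp: q_def field_simps)
    qed
    also have "\<dots> = ((\<integral>x. f (x - h n *\<^sub>R e) * \<psi> x \<partial>lebesgue) - (\<integral>x. f x * \<psi> x \<partial>lebesgue)) / h n"
      using i1 i2 tr by simp
    also have "\<dots> = (\<integral>x. (f (x - h n *\<^sub>R e) * \<psi> x - f x * \<psi> x) / h n \<partial>lebesgue)"
      using i1 i3 by simp
    also have "\<dots> = (\<integral>x. - ((f (x + (- h n) *\<^sub>R e) - f x) / (- h n) * \<psi> x) \<partial>lebesgue)"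
      by (intro Bochner_Integration.integral_cong) (auto simp: field_simps)
    finally show ?thesis by simp
  qed
  have "(\<integral>x. partial_deriv i \<psi> x * q x \<partial>lebesgue) = - (\<integral>x. g x * \<psi> x \<partial>lebesgue)"
    using LIMSEQ_unique[OF 1[unfolded 3] tendsto_minus[OF 2]] .
  moreover have "partial_deriv i \<psi> x * q x = f x * partial_deriv i \<psi> x" for x
  proof (cases "norm x \<le> R + 1")
    case False
    have "closure {x. \<psi> x \<noteq> 0} \<subseteq> cball 0 R"
      using R(2) by (intro closure_minimal) (auto simp: not_less[symmetric])
    then have "x \<notin> closure {x. \<psi> x \<noteq> 0}" using False by fastforce
    then show ?thesis by (simp add: partial_deriv_eq_0)
  qed (simp add: q_def)
  ultimately show ?thesis by simp
qed

section \<open>Smooth approximation of boxes\<close>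

text \<open>
  For \<open>c > 0\<close> these functions are flat at \<open>0\<close>: they and all their derivatives vanish there. The
  family is closed under differentiation up to linear combinations, so smoothness can be shown
  without formulas for higher derivatives.
\<close>

definition flat :: "real \<Rightarrow> nat \<Rightarrow> real \<Rightarrow> real" where
  "flat c k t = (if t > 0 then (1 / t) ^ k * exp (- (c / t)) else 0)"

lemma flat_tendsto_0:
  fixes c :: real
  assumes "c > 0"
  shows "((\<lambda>t. (1 / t) ^ k * exp (- (c / t))) \<longlongrightarrow> 0) (at_right 0)"
proof -
  have "filterlim (\<lambda>y. c * y) at_top at_top"
    by (rule filterlim_tendsto_pos_mult_at_top[OF tendsto_const assms]) (rule filterlim_ident)
  from filterlim_compose[OF tendsto_power_div_exp_0 this]
  have "((\<lambda>y. (c * y) ^ k / exp (c * y)) \<longlongrightarrow> 0) at_top" .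
  then have "((\<lambda>y. (1 / c ^ k) * ((c * y) ^ k / exp (c * y))) \<longlongrightarrow> (1 / c ^ k) * 0) at_top"
    by (intro tendsto_mult tendsto_const)
  moreover have "(1 / c ^ k) * ((c * y) ^ k / exp (c * y)) = y ^ k * exp (- (c * y))" for y
    using assms by (simp add: power_mult_distrib exp_minus field_simps)
  ultimately have "((\<lambda>y. y ^ k * exp (- (c * y))) \<longlongrightarrow> 0) at_top" by simp
  from filterlim_compose[OF this filterlim_inverse_at_top_right]
  show ?thesis by (simp add: divide_inverse)
qed

lemma DERIV_flat:
  assumes c: "c > 0"
  shows "(flat c k has_real_derivative (- real k * flat c (k + 1) t + c * flat c (k + 2) t)) (at t)"
proof -
  consider "t > 0" | "t < 0" | "t = 0" by linarith
  then show ?thesis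
  proof cases
    case 1
    have "((\<lambda>t. (1 / t) ^ k * exp (- (c / t))) has_real_derivative
            (- real k * flat c (k + 1) t + c * flat c (k + 2) t)) (at t)"
    proof (cases k)
      case 0
      then show ?thesis using 1
        by (auto intro!: derivative_eq_intros simp: flat_def power2_eq_square field_simps)
    next
      case (Suc m)
      then show ?thesis using 1
        by (auto intro!: derivative_eq_intros simp: flat_def divide_simps power_divide)
          (cases m; simp add: algebra_simps)
    qed
    then show ?thesis
      by (rule has_field_derivative_transform_within_open[where S = "{0<..}"])
        (use 1 in \<open>auto simp: flat_def\<close>)
  next
    case 2
    have "((\<lambda>_. 0) has_real_derivative (- real k * flat c (k + 1) t + c * flat c (k + 2) t)) (at t)"
      using 2 by (simp add: flat_def)
    then show ?thesis
      by (rule has_field_derivative_transform_within_open[where S = "{..<0}"])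
        (use 2 in \<open>auto simp: flat_def\<close>)
  next
    case 3
    have "((\<lambda>h. flat c k h / h) \<longlongrightarrow> 0) (at_right 0)"
    proof (rule Lim_transform_eventually[OF flat_tendsto_0[OF c, of "Suc k"]])
      show "\<forall>\<^sub>F h in at_right 0. (1 / h) ^ Suc k * exp (- (c / h)) = flat c k h / h"
        by (rule eventually_at_right_less[THEN eventually_mono]) (simp add: flat_def)
    qed
    moreover have "((\<lambda>h. flat c k h / h) \<longlongrightarrow> 0) (at_left 0)"
      by (rule tendsto_eventually) (auto simp: flat_def eventually_at_filter)
    ultimately have "((\<lambda>h. flat c k h / h) \<longlongrightarrow> 0) (at 0)"
      by (simp add: filterlim_split_at)
    then show ?thesis using 3 by (simp add: has_field_derivative_iff flat_def)
  qed
qed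

text \<open>
  The algebra generated by the functions \<open>flat c k\<close> of affine functions of one coordinate. It consists
  of differentiable functions and is closed under partial derivatives, hence all its members are
  smooth.
\<close>

inductive flat_algebra :: "real \<Rightarrow> (real^'n::finite \<Rightarrow> real) \<Rightarrow> bool" for c where
  const: "flat_algebra c (\<lambda>_. r)"
| flat: "flat_algebra c (\<lambda>x. flat c k (\<sigma> * x $ i + \<tau>))"
| add: "flat_algebra c f \<Longrightarrow> flat_algebra c g \<Longrightarrow> flat_algebra c (\<lambda>x. f x + g x)"
| mult: "flat_algebra c f \<Longrightarrow> flat_algebra c g \<Longrightarrow> flat_algebra c (\<lambda>x. f x * g x)"

lemma partial_derivI:
  "(f has_derivative D) (at x) \<Longrightarrow> partial_deriv i f x = D (axis i 1)"
  by (simp add: partial_deriv_def frechet_derivative_at[symmetric])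

lemma flat_algebra_partial_deriv:
  assumes c: "c > 0" and "flat_algebra c f"
  shows "(\<forall>x. f differentiable (at x)) \<and> flat_algebra c (partial_deriv j f)"
  using assms(2)
proof induction
  case (const r)
  have "partial_deriv j (\<lambda>_. r) = (\<lambda>_. 0)"
    by (rule ext, subst partial_derivI[where D = "\<lambda>_. 0"]) auto
  then show ?case by (auto intro: flat_algebra.const)
next
  case (flat k \<sigma> i \<tau>)
  define d where "d t = - real k * flat c (k + 1) t + c * flat c (k + 2) t" for t
  have D: "((\<lambda>x::real^'a. flat c k (\<sigma> * x $ i + \<tau>)) has_derivative (\<lambda>v. d (\<sigma> * x $ i + \<tau>) * (\<sigma> * v $ i))) (at x)" for x
  proof (rule has_derivative_compose[where f = "\<lambda>x. \<sigma> * x $ i + \<tau>" and g = "flat c k"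
        and f' = "\<lambda>v. \<sigma> * v $ i" and g' = "(*) (d (\<sigma> * x $ i + \<tau>))"])
    show "((\<lambda>x. \<sigma> * x $ i + \<tau>) has_derivative (\<lambda>v. \<sigma> * v $ i)) (at x)"
      by (auto intro!: derivative_eq_intros bounded_linear.has_derivative[OF bounded_linear_vec_nth])
    show "(flat c k has_derivative (*) (d (\<sigma> * x $ i + \<tau>))) (at (\<sigma> * x $ i + \<tau>))"
      using DERIV_flat[OF c, of k] by (simp add: d_def has_field_derivative_def)
  qed
  have "partial_deriv j (\<lambda>x. flat c k (\<sigma> * x $ i + \<tau>))
      = (\<lambda>x. (- real k * \<sigma> * axis j 1 $ i) * flat c (k + 1) (\<sigma> * x $ i + \<tau>)
           + (c * \<sigma> * axis j 1 $ i) * flat c (k + 2) (\<sigma> * x $ i + \<tau>))"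
    by (rule ext, subst partial_derivI[OF D]) (simp add: d_def algebra_simps)
  then have "flat_algebra c (partial_deriv j (\<lambda>x::real^'a. flat c k (\<sigma> * x $ i + \<tau>)))"
    by (simp only:) (intro flat_algebra.intros)
  then show ?case using D unfolding differentiable_def by blast
next
  case (add f g)
  then have D: "(f has_derivative frechet_derivative f (at x)) (at x)"
      "(g has_derivative frechet_derivative g (at x)) (at x)" for x
    by (simp_all add: frechet_derivative_works)
  have "partial_deriv j (\<lambda>x. f x + g x) = (\<lambda>x. partial_deriv j f x + partial_deriv j g x)"
    by (rule ext, subst partial_derivI[OF has_derivative_add[OF D]]) (simp add: partial_deriv_def)
  then show ?case using add by (auto intro: flat_algebra.add)
next
  case (mult f g)
  then have D: "(f has_derivative frechet_derivative f (at x)) (at x)"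
      "(g has_derivative frechet_derivative g (at x)) (at x)" for x
    by (simp_all add: frechet_derivative_works)
  have "partial_deriv j (\<lambda>x. f x * g x) = (\<lambda>x. f x * partial_deriv j g x + partial_deriv j f x * g x)"
    by (rule ext, subst partial_derivI[OF has_derivative_mult[OF D]]) (simp add: partial_deriv_def)
  then show ?case using mult by (auto intro: flat_algebra.add flat_algebra.mult)
qed

lemma flat_algebra_smooth:
  assumes "c > 0" and "flat_algebra c f"
  shows "smooth f"
proof -
  have "flat_algebra c (iter_partial \<alpha> f)" for \<alpha>
    by (induction \<alpha>) (use assms flat_algebra_partial_deriv in auto)
  then show ?thesis
    using flat_algebra_partial_deriv[OF assms(1)]
    by (auto simp: smooth_def differentiable_on_def intro: differentiable_at_withinI)
qed

lemma flat_algebra_prod: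
  "(\<And>i. i \<in> I \<Longrightarrow> flat_algebra c (f i)) \<Longrightarrow> flat_algebra c (\<lambda>x. \<Prod>i\<in>I. f i x)"
  by (induction I rule: infinite_finite_induct) (simp_all add: flat_algebra.const flat_algebra.mult)

text \<open>
  The parameter \<open>c = 1 / Suc n\<close> tends to \<open>0\<close>, so each factor \<open>exp (- c / t)\<close> tends to \<open>1\<close> for
  \<open>t > 0\<close>, while the set where the product is nonzero stays equal to the open box.
\<close>

definition box_bump :: "real^'n::finite \<Rightarrow> real^'n \<Rightarrow> nat \<Rightarrow> real^'n \<Rightarrow> real" where
  "box_bump a b n x =
     (\<Prod>i\<in>UNIV. flat (1 / Suc n) 0 (x $ i - a $ i) * flat (1 / Suc n) 0 (b $ i - x $ i))"

lemma flat_range: "c \<ge> 0 \<Longrightarrow> 0 \<le> flat c 0 t \<and> flat c 0 t \<le> 1"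
  by (simp add: flat_def)

lemma box_bump_range: "0 \<le> box_bump a b n x \<and> box_bump a b n x \<le> 1"
proof -
  have "0 \<le> flat (1 / Suc n) 0 s * flat (1 / Suc n) 0 t \<and> flat (1 / Suc n) 0 s * flat (1 / Suc n) 0 t \<le> 1" for s t
    using flat_range[of "1 / Suc n" s] flat_range[of "1 / Suc n" t] by (simp add: mult_le_one)
  then show ?thesis unfolding box_bump_def by (intro conjI prod_nonneg prod_le_1) auto
qed

lemma box_bump_nonzero: "box_bump a b n x \<noteq> 0 \<longleftrightarrow> x \<in> box a b"
  by (auto simp: box_bump_def mem_box_cart flat_def split: if_splits)

lemma box_bump_tendsto: "(\<lambda>n. box_bump a b n x) \<longlonglongrightarrow> indicator (box a b) x"
proof (cases "x \<in> box a b")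
  case True
  have *: "(\<lambda>n. flat (1 / Suc n) 0 t) \<longlonglongrightarrow> 1" if "t > 0" for t
  proof -
    have "(\<lambda>n. exp (- (1 / real (Suc n) / t))) \<longlonglongrightarrow> exp (- (0 / t))"
      using LIMSEQ_inverse_real_of_nat
      by (intro tendsto_intros) (use that in \<open>auto simp: inverse_eq_divide\<close>)
    then show ?thesis using that by (simp add: flat_def)
  qed
  have "(\<lambda>n. box_bump a b n x) \<longlonglongrightarrow> (\<Prod>i\<in>(UNIV::'a set). 1 * 1)"
    unfolding box_bump_def using True by (intro tendsto_prod tendsto_mult *) (auto simp: mem_box_cart)
  then show ?thesis using True by simp
next
  case False
  then show ?thesis using box_bump_nonzero[of a b _ x] by auto
qed

lemma box_bump_test:
  assumes "cbox a b \<subseteq> \<Omega>"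
  shows "box_bump a b n \<in> test_functions \<Omega>"
proof -
  have "flat_algebra (1 / Suc n) (box_bump a b n)"
    unfolding box_bump_def
  proof (intro flat_algebra_prod flat_algebra.mult)
    fix i
    show "flat_algebra (1 / Suc n) (\<lambda>x. flat (1 / Suc n) 0 (x $ i - a $ i))"
      using flat_algebra.flat[of "1 / Suc n" 0 1 i "- a $ i"] by simp
    show "flat_algebra (1 / Suc n) (\<lambda>x. flat (1 / Suc n) 0 (b $ i - x $ i))"
      using flat_algebra.flat[of "1 / Suc n" 0 "-1" i "b $ i"] by (simp add: add.commute)
  qed
  then have "smooth (box_bump a b n)" by (rule flat_algebra_smooth[rotated]) simp
  moreover have "closure {x. box_bump a b n x \<noteq> 0} \<subseteq> cbox a b"
    unfolding box_bump_nonzero using box_subset_cbox by (intro closure_minimal) auto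
  moreover from this have "compact (closure {x. box_bump a b n x \<noteq> 0})"
    by (meson bounded_cbox bounded_subset closed_closure compact_eq_bounded_closed)
  ultimately show ?thesis using assms by (auto simp: test_functions_def)
qed

section \<open>Uniqueness of weak derivatives\<close>

text \<open>
  Fix a closed box contained in \<open>\<Omega>\<close> and restrict \<open>g\<close> to its interior. The Borel sets over which the
  restriction integrates to \<open>0\<close> form a Dynkin system containing all open boxes, a generator of the
  Borel sets that is stable under intersections. So all Borel sets have this property, and \<open>g\<close>
  vanishes almost everywhere on the box. Countably many such boxes cover \<open>\<Omega>\<close>.
\<close>

lemma AE_zero_if_box_integrals_zero:
  fixes g :: "'a::euclidean_space \<Rightarrow> real"
  assumes g: "integrable lborel g" and \<Omega>: "open \<Omega>"
    and z: "\<And>a b. cbox a b \<subseteq> \<Omega> \<Longrightarrow> (\<integral>x. indicator (box a b) x * g x \<partial>lborel) = 0"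
  shows "AE x in lborel. x \<in> \<Omega> \<longrightarrow> g x = 0"
proof -
  have local_zero: "AE x in lborel. x \<in> cbox a b \<longrightarrow> g x = 0" if ab: "cbox a b \<subseteq> \<Omega>" for a b
  proof -
    define gB where "gB x = indicator (box a b) x * g x" for x
    have gB: "integrable lborel gB"
      using integrable_mult_indicator[OF _ g, of "box a b"] by (simp add: gB_def[abs_def])
    have set_int: "set_integrable lborel A gB" if "A \<in> sets borel" for A
      unfolding set_integrable_def using that by (intro integrable_mult_indicator[OF _ gB]) simp
    have "(LINT x:A|lborel. gB x) = 0" if "A \<in> sets borel" for A
    proof -
      have "Int_stable (range (\<lambda>(a, b). box a b :: 'a set))"
        unfolding Int_stable_def by (auto simp: box_Int_box)
      moreover have "range (\<lambda>(a, b). box a b :: 'a set) \<subseteq> Pow UNIV" by simp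
      moreover have "A \<in> sigma_sets UNIV (range (\<lambda>(a, b). box a b :: 'a set))"
        using that by (simp add: borel_eq_box)
      ultimately show ?thesis
      proof (induction rule: sigma_sets_induct_disjoint)
        case (basic A)
        then obtain c d where A: "A = box c d" by auto
        obtain p q where pq: "box c d \<inter> box a b = box p q" "cbox c d \<inter> cbox a b = cbox p q"
          using box_Int_box[of c d a b] Int_interval[of c d a b] by blast
        have "(LINT x:A|lborel. gB x) = (\<integral>x. indicator (box p q) x * g x \<partial>lborel)"
          unfolding A set_lebesgue_integral_def gB_def pq(1)[symmetric]
          by (intro Bochner_Integration.integral_cong) (auto simp: indicator_def)
        also have "\<dots> = 0" using z[of p q] ab pq(2) by auto
        finally show ?case .
      next
        case (compl A)
        then have A: "A \<in> sets borel" by (simp add: borel_eq_box)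
        have "(LINT x:UNIV - A|lborel. gB x) = (\<integral>x. gB x - indicator A x *\<^sub>R gB x \<partial>lborel)"
          unfolding set_lebesgue_integral_def
          by (intro Bochner_Integration.integral_cong) (auto simp: indicator_def)
        also have "\<dots> = (\<integral>x. gB x \<partial>lborel) - (LINT x:A|lborel. gB x)"
          using gB set_int[OF A] unfolding set_lebesgue_integral_def set_integrable_def by simp
        also have "\<dots> = 0" using z[OF ab] compl by (simp add: gB_def)
        finally show ?case .
      next
        case (union A)
        then have A: "A i \<in> sets borel" for i by (auto simp: borel_eq_box)
        then have "(LINT x:(\<Union>i. A i)|lborel. gB x) = (\<Sum>i. LINT x:A i|lborel. gB x)"
          using union by (intro lebesgue_integral_countable_add set_int) (auto simp: disjoint_family_on_def)
        then show ?case using union by simp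
      qed (auto simp: set_lebesgue_integral_def)
    qed
    then have "AE x in lborel. gB x = 0"
      using sigma_finite_measure.density_zero[OF sigma_finite_lborel gB] by simp
    moreover have "AE x in lborel. x \<notin> cbox a b - box a b"
    proof -
      have "cbox a b - box a b \<in> null_sets lebesgue"
        using negligible_frontier_interval[of a b] by (simp add: negligible_iff_null_sets)
      then have "AE x in lebesgue. x \<notin> cbox a b - box a b" by (rule AE_not_in)
      then show ?thesis by (simp add: AE_completion_iff)
    qed
    ultimately show ?thesis by eventually_elim (auto simp: gB_def)
  qed
  define l r where "l f = (\<Sum>i\<in>Basis. fst (f i) *\<^sub>R (i::'a))" and "r f = (\<Sum>i\<in>Basis. snd (f i) *\<^sub>R (i::'a))"
    for f :: "'a \<Rightarrow> real \<times> real"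
  define I where "I = {f\<in>Basis \<rightarrow>\<^sub>E \<rat> \<times> \<rat>. cbox (l f) (r f) \<subseteq> \<Omega>}"
  have "countable I"
    unfolding I_def
    by (rule countable_subset[OF _ countable_PiE[of "Basis::'a set" "\<lambda>_. \<rat> \<times> \<rat> :: (real \<times> real) set"]])
      (auto intro: countable_rat)
  then have "AE x in lborel. \<forall>f\<in>I. x \<in> cbox (l f) (r f) \<longrightarrow> g x = 0"
    by (subst AE_ball_countable) (use local_zero in \<open>auto simp: I_def\<close>)
  moreover have "\<Omega> = (\<Union>f\<in>I. cbox (l f) (r f))"
    using open_UNION_cbox[OF \<Omega>] unfolding I_def l_def r_def .
  ultimately show ?thesis by (auto elim!: eventually_mono)
qed

context bounded_open_set
begin

text \<open>
  The fundamental lemma of the calculus of variations. The functions \<open>box_bump a b n\<close> converge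
  boundedly to the indicator of the box, so the integral of \<open>G\<close> over every box in \<open>\<Omega>\<close> is \<open>0\<close>.
\<close>

proposition AE_zero_if_test_integrals_zero:
  assumes G: "integrable (lebesgue_on \<Omega>) G"
    and z: "\<And>\<phi>. \<phi> \<in> test_functions \<Omega> \<Longrightarrow> (\<integral>x. G x * \<phi> x \<partial>lebesgue_on \<Omega>) = 0"
  shows "AE x in lebesgue_on \<Omega>. G x = 0"
proof -
  define G0 where "G0 x = (if x \<in> \<Omega> then G x else 0)" for x
  have G0: "integrable lebesgue G0"
    unfolding G0_def using G by (simp add: Lebesgue_Measure.integrable_restrict_UNIV)
  \<comment> \<open>The Dynkin argument needs Borel sets, so \<open>G\<close> is replaced by a Borel function that agrees with it
    almost everywhere.\<close>
  then obtain g where gm: "g \<in> borel_measurable lborel" and "AE x in lborel. G0 x = g x"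
    using completion_ex_borel_measurable_real[of G0 lborel] by auto
  then have gG: "AE x in lebesgue. G0 x = g x" by (simp add: AE_completion)
  have "integrable lebesgue G0 = integrable lebesgue g"
    using G0 gm gG by (intro integrable_cong_AE) (auto simp: measurable_completion)
  with G0 have "integrable lebesgue g" by simp
  then have g: "integrable lborel g" using gm by (simp add: integrable_completion)
  have "(\<integral>x. indicator (box a b) x * g x \<partial>lborel) = 0" if ab: "cbox a b \<subseteq> \<Omega>" for a b
  proof -
    have "(\<lambda>n. \<integral>x. box_bump a b n x * g x \<partial>lborel) \<longlonglongrightarrow> (\<integral>x. indicator (box a b) x * g x \<partial>lborel)"
    proof (rule integral_dominated_convergence[where w = "\<lambda>x. \<bar>g x\<bar>"])
      show "(\<lambda>x. box_bump a b n x * g x) \<in> borel_measurable lborel" for n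
        using gm test_measurable[OF box_bump_test[OF ab]] by simp
      show "AE x in lborel. (\<lambda>n. box_bump a b n x * g x) \<longlonglongrightarrow> indicator (box a b) x * g x"
        by (intro AE_I2 tendsto_mult tendsto_const box_bump_tendsto)
      show "AE x in lborel. norm (box_bump a b n x * g x) \<le> \<bar>g x\<bar>" for n
        using box_bump_range[of a b n]
        by (intro AE_I2) (auto simp: abs_mult intro!: mult_left_le_one_le)
    qed (use gm g in auto)
    moreover have "(\<integral>x. box_bump a b n x * g x \<partial>lborel) = 0" for n
    proof -
      have T: "box_bump a b n \<in> test_functions \<Omega>" by (rule box_bump_test[OF ab])
      have "(\<integral>x. box_bump a b n x * g x \<partial>lborel) = (\<integral>x. box_bump a b n x * g x \<partial>lebesgue)"
        using gm test_measurable[OF T] by (intro integral_completion[symmetric]) simp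
      also have "\<dots> = (\<integral>x. G0 x * box_bump a b n x \<partial>lebesgue)"
        using gm test_measurable[OF T] borel_measurable_integrable[OF G0] gG
        by (intro integral_cong_AE borel_measurable_times)
          (auto simp: measurable_completion elim!: eventually_mono)
      also have "\<dots> = (\<integral>x. G0 x * box_bump a b n x \<partial>lebesgue_on \<Omega>)"
        by (rule integral_eq_lebesgue[symmetric]) (simp add: G0_def)
      also have "\<dots> = (\<integral>x. G x * box_bump a b n x \<partial>lebesgue_on \<Omega>)"
        by (intro Bochner_Integration.integral_cong) (auto simp: G0_def)
      finally show ?thesis using z[OF T] by simp
    qed
    ultimately show ?thesis by (simp add: LIMSEQ_const_iff)
  qed
  then have "AE x in lborel. x \<in> \<Omega> \<longrightarrow> g x = 0"
    by (intro AE_zero_if_box_integrals_zero g open_\<Omega>)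
  then have "AE x in lebesgue. x \<in> \<Omega> \<longrightarrow> g x = 0" by (rule AE_completion)
  with gG have "AE x in lebesgue. x \<in> \<Omega> \<longrightarrow> G x = 0"
    by eventually_elim (auto simp: G0_def)
  then show ?thesis by (simp add: AE_restrict_space_iff)
qed

lemma weak_deriv_unique:
  assumes "g \<in> L2_space \<Omega>" "g' \<in> L2_space \<Omega>" "is_weak_deriv \<Omega> \<alpha> u g" "is_weak_deriv \<Omega> \<alpha> u g'"
  shows "AE x in lebesgue_on \<Omega>. g x = g' x"
proof -
  have "AE x in lebesgue_on \<Omega>. g x - g' x = 0"
  proof (rule AE_zero_if_test_integrals_zero)
    show "integrable (lebesgue_on \<Omega>) (\<lambda>x. g x - g' x)"
      using assms by (intro L2_integrable L2_diff)
    fix \<phi> assume \<phi>: "\<phi> \<in> test_functions \<Omega>"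
    have "(\<integral>x. g x * \<phi> x \<partial>lebesgue_on \<Omega>) = (\<integral>x. g' x * \<phi> x \<partial>lebesgue_on \<Omega>)"
      using assms(3,4) \<phi> unfolding is_weak_deriv_def by simp
    then show "(\<integral>x. (g x - g' x) * \<phi> x \<partial>lebesgue_on \<Omega>) = 0"
      using assms(1,2) L2_mult_integrable[OF _ test_L2[OF \<phi>]] by (simp add: left_diff_distrib)
  qed
  then show ?thesis by simp
qed

text \<open>
  Any weak derivative that is known explicitly determines the chosen one almost everywhere.
\<close>

lemma weak_deriv_works:
  assumes "g \<in> L2_space \<Omega>" "is_weak_deriv \<Omega> \<alpha> u g"
  shows "weak_deriv \<Omega> \<alpha> u \<in> L2_space \<Omega>" "is_weak_deriv \<Omega> \<alpha> u (weak_deriv \<Omega> \<alpha> u)"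
    "AE x in lebesgue_on \<Omega>. weak_deriv \<Omega> \<alpha> u x = g x"
proof -
  have "weak_deriv \<Omega> \<alpha> u \<in> L2_space \<Omega> \<and> is_weak_deriv \<Omega> \<alpha> u (weak_deriv \<Omega> \<alpha> u)"
    unfolding weak_deriv_def
    using someI[of "\<lambda>g. g \<in> L2_space \<Omega> \<and> is_weak_deriv \<Omega> \<alpha> u g" g] assms by blast
  then show "weak_deriv \<Omega> \<alpha> u \<in> L2_space \<Omega>" "is_weak_deriv \<Omega> \<alpha> u (weak_deriv \<Omega> \<alpha> u)"
    "AE x in lebesgue_on \<Omega>. weak_deriv \<Omega> \<alpha> u x = g x"
    using weak_deriv_unique[OF _ assms(1) _ assms(2)] by blast+
qed

lemma sobolev_weak_deriv:
  assumes "u \<in> sobolev_H m \<Omega>" "length \<alpha> \<le> m"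
  shows "weak_deriv \<Omega> \<alpha> u \<in> L2_space \<Omega>" "is_weak_deriv \<Omega> \<alpha> u (weak_deriv \<Omega> \<alpha> u)"
proof -
  obtain g where "g \<in> L2_space \<Omega>" "is_weak_deriv \<Omega> \<alpha> u g"
    using assms unfolding sobolev_H_def by blast
  then show "weak_deriv \<Omega> \<alpha> u \<in> L2_space \<Omega>" "is_weak_deriv \<Omega> \<alpha> u (weak_deriv \<Omega> \<alpha> u)"
    by (rule weak_deriv_works)+
qed

lemma sobolev_L2: "u \<in> sobolev_H m \<Omega> \<Longrightarrow> u \<in> L2_space \<Omega>"
  by (simp add: sobolev_H_def)

lemma is_weak_deriv_diff:
  assumes "u \<in> L2_space \<Omega>" "u' \<in> L2_space \<Omega>" "g \<in> L2_space \<Omega>" "g' \<in> L2_space \<Omega>"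
    and "is_weak_deriv \<Omega> \<alpha> u g" "is_weak_deriv \<Omega> \<alpha> u' g'"
  shows "is_weak_deriv \<Omega> \<alpha> (\<lambda>x. u x - u' x) (\<lambda>x. g x - g' x)"
  unfolding is_weak_deriv_def
proof
  fix \<phi> assume \<phi>: "\<phi> \<in> test_functions \<Omega>"
  note I = L2_mult_integrable[OF _ test_L2[OF \<phi>]] L2_mult_integrable[OF _ test_L2[OF test_iter_partial[OF \<phi>]]]
  show "(\<integral>x. (u x - u' x) * iter_partial \<alpha> \<phi> x \<partial>lebesgue_on \<Omega>) =
        (-1) ^ length \<alpha> * (\<integral>x. (g x - g' x) * \<phi> x \<partial>lebesgue_on \<Omega>)"
    using assms(5,6) \<phi> I assms(1-4) unfolding is_weak_deriv_def
    by (simp add: left_diff_distrib right_diff_distrib)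
qed

end

section \<open>Derivatives vanish on zero sets\<close>

context bounded_open_set
begin

lemma lipschitz_partial_integral:
  assumes "lipschitz_partial i f g" "\<phi> \<in> test_functions \<Omega>"
  shows "(\<integral>x. f x * partial_deriv i \<phi> x \<partial>lebesgue_on \<Omega>) = - (\<integral>x. g x * \<phi> x \<partial>lebesgue_on \<Omega>)"
  using integration_by_parts[OF assms] test_eq_0[OF assms(2)] test_eq_0[OF test_partial_deriv[OF assms(2)]]
  by (simp add: integral_eq_lebesgue)

text \<open>
  Here \<open>g\<close> is a strong derivative of \<open>f\<close> in the direction \<open>i\<close>: the pair is an \<open>L\<^sup>2\<close> limit of functions
  with their almost everywhere derivatives.
\<close>

definition approximable_pair :: "'n \<Rightarrow> (real^'n \<Rightarrow> real) \<Rightarrow> (real^'n \<Rightarrow> real) \<Rightarrow> bool" where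
  "approximable_pair i f g \<longleftrightarrow> f \<in> L2_space \<Omega> \<and> g \<in> L2_space \<Omega> \<and>
     (\<forall>\<epsilon>>0. \<exists>a b. lipschitz_partial i a b \<and> a \<in> L2_space \<Omega> \<and> b \<in> L2_space \<Omega> \<and>
        L2_norm (\<lambda>x. f x - a x) < \<epsilon> \<and> L2_norm (\<lambda>x. g x - b x) < \<epsilon>)"

text \<open>
  For the approximating pairs \<open>(a, b)\<close> this is integration by parts for \<open>F \<circ> a\<close>. The bounds on \<open>F'\<close>
  and its Lipschitz constant control the error by a multiple of the two \<open>L\<^sup>2\<close> distances.
\<close>

lemma weak_chain_rule:
  assumes fg: "approximable_pair i f g"
    and F: "\<And>t. (F has_real_derivative F' t) (at t)" "\<And>t. \<bar>F t\<bar> \<le> C"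
    and F': "\<And>t. \<bar>F' t\<bar> \<le> 1" "\<And>s t. \<bar>F' s - F' t\<bar> \<le> K * \<bar>s - t\<bar>" "continuous_on UNIV F'"
    and \<phi>: "\<phi> \<in> test_functions \<Omega>"
  shows "(\<integral>x. F (f x) * partial_deriv i \<phi> x \<partial>lebesgue_on \<Omega>) =
    - (\<integral>x. F' (f x) * g x * \<phi> x \<partial>lebesgue_on \<Omega>)"
proof -
  have f: "f \<in> L2_space \<Omega>" and g: "g \<in> L2_space \<Omega>"
    using fg by (simp_all add: approximable_pair_def)
  define P where "P = partial_deriv i \<phi>"
  have P: "P \<in> L2_space \<Omega>" and \<phi>2: "\<phi> \<in> L2_space \<Omega>"
    using test_L2 \<phi> test_partial_deriv by (auto simp: P_def)
  obtain M where M: "0 \<le> M" "\<And>x. \<bar>\<phi> x\<bar> \<le> M" using test_bounded[OF \<phi>] by blast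
  have "0 \<le> K" using F'(2)[of 0 1] by simp
  have "F \<in> borel_measurable borel"
    using F(1) by (intro borel_measurable_continuous_onI DERIV_continuous_on) auto
  then have Fm: "(\<lambda>x. F (h x)) \<in> borel_measurable (lebesgue_on \<Omega>)" if "h \<in> L2_space \<Omega>" for h
    using measurable_compose[OF L2_measurable[OF that]] by blast
  have "F' \<in> borel_measurable borel"
    using F'(3) by (rule borel_measurable_continuous_onI)
  then have F'm: "(\<lambda>x. F' (h x)) \<in> borel_measurable (lebesgue_on \<Omega>)" if "h \<in> L2_space \<Omega>" for h
    using measurable_compose[OF L2_measurable[OF that]] by blast
  have FP: "integrable (lebesgue_on \<Omega>) (\<lambda>x. F (h x) * P x)" if "h \<in> L2_space \<Omega>" for h
    using F(2) that by (intro L2_mult_integrable[OF L2_bounded P] Fm)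
  have F'\<phi>: "integrable (lebesgue_on \<Omega>) (\<lambda>x. F' (h x) * h' x * \<phi> x)"
    if "h \<in> L2_space \<Omega>" "h' \<in> L2_space \<Omega>" for h h'
    using F'(1) that by (intro L2_mult_integrable[OF L2_bounded_mult \<phi>2] F'm)
  have F_lip: "\<bar>F r - F s\<bar> \<le> \<bar>r - s\<bar>" for r s
    using field_differentiable_bound[of UNIV F F' 1 r s] F F'(1) by auto
  define D where "D = (\<integral>x. F (f x) * P x \<partial>lebesgue_on \<Omega>) + (\<integral>x. F' (f x) * g x * \<phi> x \<partial>lebesgue_on \<Omega>)"
  define N where "N = L2_norm P + L2_norm \<phi> + (K * M) * L2_norm g"
  have "0 \<le> N" unfolding N_def using \<open>0 \<le> K\<close> M(1) L2_norm_nonneg by (intro add_nonneg_nonneg mult_nonneg_nonneg)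
  have bound: "\<bar>D\<bar> \<le> \<epsilon> * N" if \<epsilon>: "\<epsilon> > 0" for \<epsilon>
  proof -
    obtain a b where ab: "lipschitz_partial i a b" "a \<in> L2_space \<Omega>" "b \<in> L2_space \<Omega>"
      "L2_norm (\<lambda>x. f x - a x) < \<epsilon>" "L2_norm (\<lambda>x. g x - b x) < \<epsilon>"
      using fg \<epsilon> unfolding approximable_pair_def by blast
    have zero: "(\<integral>x. F (a x) * P x \<partial>lebesgue_on \<Omega>) + (\<integral>x. F' (a x) * b x * \<phi> x \<partial>lebesgue_on \<Omega>) = 0"
      using lipschitz_partial_integral[OF lipschitz_partial_compose[OF ab(1) F(1) F'(1,3)] \<phi>]
      by (simp add: P_def)
    \<comment> \<open>The factors are exchanged one at a time, so that each difference is paired with a fixed \<open>L\<^sup>2\<close>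
      function; only \<open>D3\<close> uses the Lipschitz bound for \<open>F'\<close>.\<close>
    define D1 D2 D3 where
      "D1 = (\<integral>x. (F (f x) - F (a x)) * P x \<partial>lebesgue_on \<Omega>)" and
      "D2 = (\<integral>x. F' (a x) * (g x - b x) * \<phi> x \<partial>lebesgue_on \<Omega>)" and
      "D3 = (\<integral>x. (F' (f x) - F' (a x)) * g x * \<phi> x \<partial>lebesgue_on \<Omega>)"
    note int = FP[OF f] FP[OF ab(2)] F'\<phi>[OF f g] F'\<phi>[OF ab(2) g] F'\<phi>[OF ab(2,3)]
    have "D = D1 + D2 + D3"
      using zero int by (simp add: D_def D1_def D2_def D3_def left_diff_distrib right_diff_distrib)
    moreover have "\<bar>D1\<bar> \<le> L2_norm (\<lambda>x. f x - a x) * L2_norm P"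
      unfolding D1_def
    proof (rule integral_mult_le_L2[OF _ L2_diff[OF f ab(2)] P])
      show "integrable (lebesgue_on \<Omega>) (\<lambda>x. (F (f x) - F (a x)) * P x)"
        using int by (simp add: left_diff_distrib)
      show "\<bar>(F (f x) - F (a x)) * P x\<bar> \<le> \<bar>(f x - a x) * P x\<bar>" for x
        using F_lip by (simp add: abs_mult mult_right_mono)
    qed
    moreover have "\<bar>D2\<bar> \<le> L2_norm (\<lambda>x. g x - b x) * L2_norm \<phi>"
      unfolding D2_def
    proof (rule integral_mult_le_L2[OF _ L2_diff[OF g ab(3)] \<phi>2])
      show "integrable (lebesgue_on \<Omega>) (\<lambda>x. F' (a x) * (g x - b x) * \<phi> x)"
        using int by (simp add: left_diff_distrib right_diff_distrib)
      show "\<bar>F' (a x) * (g x - b x) * \<phi> x\<bar> \<le> \<bar>(g x - b x) * \<phi> x\<bar>" for x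
        using F'(1) by (simp add: abs_mult mult.assoc mult_left_le_one_le)
    qed
    moreover
    have "\<bar>D3\<bar> \<le> L2_norm (\<lambda>x. f x - a x) * L2_norm (\<lambda>x. (K * M) * g x)"
      unfolding D3_def
    proof (rule integral_mult_le_L2[OF _ L2_diff[OF f ab(2)] L2_cmult[OF g]])
      show "integrable (lebesgue_on \<Omega>) (\<lambda>x. (F' (f x) - F' (a x)) * g x * \<phi> x)"
        using int by (simp add: left_diff_distrib)
      show "\<bar>(F' (f x) - F' (a x)) * g x * \<phi> x\<bar> \<le> \<bar>(f x - a x) * (K * M * g x)\<bar>" for x
      proof -
        have "\<bar>F' (f x) - F' (a x)\<bar> * \<bar>\<phi> x\<bar> * \<bar>g x\<bar> \<le> (K * \<bar>f x - a x\<bar>) * M * \<bar>g x\<bar>"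
          using F'(2) M \<open>0 \<le> K\<close> by (intro mult_right_mono mult_mono) auto
        then show ?thesis using \<open>0 \<le> K\<close> M(1) by (simp add: abs_mult mult_ac)
      qed
    qed
    then have "\<bar>D3\<bar> \<le> L2_norm (\<lambda>x. f x - a x) * ((K * M) * L2_norm g)"
      using \<open>0 \<le> K\<close> M(1) by (simp add: L2_norm_def power_mult_distrib real_sqrt_mult real_sqrt_abs abs_mult)
    ultimately have "\<bar>D\<bar> \<le> L2_norm (\<lambda>x. f x - a x) * L2_norm P
        + L2_norm (\<lambda>x. g x - b x) * L2_norm \<phi> + L2_norm (\<lambda>x. f x - a x) * ((K * M) * L2_norm g)"
      by linarith
    also have "\<dots> \<le> \<epsilon> * L2_norm P + \<epsilon> * L2_norm \<phi> + \<epsilon> * ((K * M) * L2_norm g)"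
      using ab(4,5) \<open>0 \<le> K\<close> M(1)
      by (intro add_mono mult_right_mono mult_nonneg_nonneg L2_norm_nonneg) auto
    finally show ?thesis by (simp add: N_def algebra_simps)
  qed
  have "D = 0" by (rule eq_0_if_arbitrarily_small[OF \<open>0 \<le> N\<close> bound])
  then show ?thesis by (simp add: D_def P_def)
qed

text \<open>
  The scaled arctangent tends to \<open>0\<close> uniformly as \<open>N\<close> grows, while its derivative stays between \<open>0\<close>
  and \<open>1\<close> and tends to the indicator of \<open>{0}\<close>. These are the functions \<open>F\<close> of the chain rule.
\<close>

lemma arctan_profile:
  fixes N t :: real
  assumes N: "N > 0"
  shows "((\<lambda>t. arctan (N * t) / N) has_real_derivative 1 / (1 + (N * t)\<^sup>2)) (at t)"
    and "\<bar>arctan (N * t) / N\<bar> \<le> pi / 2 / N"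
    and "\<bar>1 / (1 + (N * t)\<^sup>2)\<bar> \<le> 1"
    and "\<bar>1 / (1 + (N * s)\<^sup>2) - 1 / (1 + (N * t)\<^sup>2)\<bar> \<le> N * \<bar>s - t\<bar>"
    and "continuous_on UNIV (\<lambda>t. 1 / (1 + (N * t)\<^sup>2))"
proof -
  have pos: "1 + (N * r)\<^sup>2 > 0" for r by (rule add_pos_nonneg) auto
  show "((\<lambda>t. arctan (N * t) / N) has_real_derivative 1 / (1 + (N * t)\<^sup>2)) (at t)"
  proof -
    have "((\<lambda>t. arctan (N * t) / N) has_real_derivative inverse (1 + (N * t)\<^sup>2) * N / N) (at t)"
      by (auto intro!: derivative_eq_intros)
    then show ?thesis using N by (simp add: inverse_eq_divide)
  qed
  have "\<bar>arctan (N * t)\<bar> \<le> pi / 2" using arctan_bounded[of "N * t"] by linarith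
  then show "\<bar>arctan (N * t) / N\<bar> \<le> pi / 2 / N"
    using N divide_right_mono[of "\<bar>arctan (N * t)\<bar>" "pi / 2" N] by (simp add: abs_divide)
  show "\<bar>1 / (1 + (N * t)\<^sup>2)\<bar> \<le> 1" using pos[of t] by (simp add: divide_le_eq_1)
  show "continuous_on UNIV (\<lambda>t. 1 / (1 + (N * t)\<^sup>2))"
    using pos by (intro continuous_intros) (metis less_irrefl)
  define p q where "p = N * s" and "q = N * t"
  have "\<bar>p + q\<bar> \<le> (1 + p\<^sup>2) * (1 + q\<^sup>2)"
  proof -
    have "0 \<le> (\<bar>p\<bar> - 1)\<^sup>2" "0 \<le> (\<bar>q\<bar> - 1)\<^sup>2" by simp_all
    then have "\<bar>p\<bar> \<le> 1/2 + p\<^sup>2 / 2" "\<bar>q\<bar> \<le> 1/2 + q\<^sup>2 / 2" by (simp_all add: power2_diff)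
    moreover have "0 \<le> p\<^sup>2 * q\<^sup>2" "0 \<le> p\<^sup>2" "0 \<le> q\<^sup>2" by simp_all
    moreover have "(1 + p\<^sup>2) * (1 + q\<^sup>2) = 1 + p\<^sup>2 + q\<^sup>2 + p\<^sup>2 * q\<^sup>2"
      by (simp add: algebra_simps)
    ultimately show ?thesis by linarith
  qed
  then have "\<bar>p - q\<bar> * \<bar>p + q\<bar> \<le> \<bar>p - q\<bar> * ((1 + p\<^sup>2) * (1 + q\<^sup>2))" by (intro mult_left_mono) auto
  moreover have "1 / (1 + p\<^sup>2) - 1 / (1 + q\<^sup>2) = (q - p) * (q + p) / ((1 + p\<^sup>2) * (1 + q\<^sup>2))"
    using pos[of s] pos[of t] by (simp add: p_def q_def field_simps power2_eq_square)
  ultimately have "\<bar>1 / (1 + p\<^sup>2) - 1 / (1 + q\<^sup>2)\<bar> \<le> \<bar>p - q\<bar>"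
    using pos[of s] pos[of t]
    by (simp add: p_def[symmetric] q_def[symmetric] abs_mult abs_divide divide_le_eq abs_minus_commute add.commute)
  also have "\<bar>p - q\<bar> = N * \<bar>s - t\<bar>"
    using N by (simp add: p_def q_def abs_mult right_diff_distrib[symmetric])
  finally show "\<bar>1 / (1 + (N * s)\<^sup>2) - 1 / (1 + (N * t)\<^sup>2)\<bar> \<le> N * \<bar>s - t\<bar>"
    by (simp add: p_def q_def)
qed

text \<open>
  In the chain rule for \<open>F\<^sub>n t = arctan (N t) / N\<close>, with \<open>N = n + 1\<close>, the left-hand side tends to \<open>0\<close> and
  the right-hand side to minus the integral of \<open>g \<phi>\<close> over \<open>{f = 0}\<close>. So \<open>g\<close> restricted to \<open>{f = 0}\<close> is
  orthogonal to all test functions.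
\<close>

proposition derivative_zero_on_zero_set:
  assumes fg: "approximable_pair i f g"
  shows "AE x in lebesgue_on \<Omega>. f x = 0 \<longrightarrow> g x = 0"
proof -
  have f: "f \<in> L2_space \<Omega>" and g: "g \<in> L2_space \<Omega>"
    using fg by (simp_all add: approximable_pair_def)
  define Z where "Z t = (if t = 0 then 1 else 0 :: real)" for t :: real
  have Zm: "(\<lambda>x. Z (f x)) \<in> borel_measurable (lebesgue_on \<Omega>)"
    unfolding Z_def using L2_measurable[OF f] by measurable
  have Zg: "(\<lambda>x. Z (f x) * g x) \<in> L2_space \<Omega>"
    by (rule L2_bounded_mult[OF Zm _ g, where C = 1]) (simp add: Z_def)
  have "AE x in lebesgue_on \<Omega>. Z (f x) * g x = 0"
  proof (rule AE_zero_if_test_integrals_zero[OF L2_integrable[OF Zg]])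
    fix \<phi> assume \<phi>: "\<phi> \<in> test_functions \<Omega>"
    define F F' where "F n t = arctan (real (Suc n) * t) / real (Suc n)"
      and "F' n t = 1 / (1 + (real (Suc n) * t)\<^sup>2)" for n t
    have chain: "(\<integral>x. F n (f x) * partial_deriv i \<phi> x \<partial>lebesgue_on \<Omega>)
        = - (\<integral>x. F' n (f x) * g x * \<phi> x \<partial>lebesgue_on \<Omega>)" for n
      unfolding F_def F'_def by (rule weak_chain_rule[OF fg arctan_profile \<phi>]) simp_all
    have P: "partial_deriv i \<phi> \<in> L2_space \<Omega>" using test_L2 test_partial_deriv \<phi> by blast
    define Q where "Q = (\<integral>x. \<bar>partial_deriv i \<phi> x\<bar> \<partial>lebesgue_on \<Omega>)"
    have f1: "(\<lambda>n. \<integral>x. F n (f x) * partial_deriv i \<phi> x \<partial>lebesgue_on \<Omega>) \<longlonglongrightarrow> 0"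
    proof (rule Lim_null_comparison)
      show "\<forall>\<^sub>F n in sequentially. norm (\<integral>x. F n (f x) * partial_deriv i \<phi> x \<partial>lebesgue_on \<Omega>)
          \<le> (pi / 2 * Q) * inverse (real (Suc n))"
      proof (intro always_eventually allI)
        fix n
        have "norm (\<integral>x. F n (f x) * partial_deriv i \<phi> x \<partial>lebesgue_on \<Omega>)
            \<le> (\<integral>x. pi / 2 / real (Suc n) * \<bar>partial_deriv i \<phi> x\<bar> \<partial>lebesgue_on \<Omega>)"
        proof (rule Bochner_Integration.integral_norm_bound_integral)
          have m: "(\<lambda>x. F n (f x)) \<in> borel_measurable (lebesgue_on \<Omega>)"
            unfolding F_def using L2_measurable[OF f] by measurable
          have b: "\<bar>F n (f x)\<bar> \<le> pi / 2 / real (Suc n)" for x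
            unfolding F_def by (rule arctan_profile) simp
          show "integrable (lebesgue_on \<Omega>) (\<lambda>x. F n (f x) * partial_deriv i \<phi> x)"
            by (rule L2_mult_integrable[OF L2_bounded[OF m b] P])
          show "integrable (lebesgue_on \<Omega>) (\<lambda>x. pi / 2 / real (Suc n) * \<bar>partial_deriv i \<phi> x\<bar>)"
            using L2_integrable[OF P] by simp
          show "norm (F n (f x) * partial_deriv i \<phi> x) \<le> pi / 2 / real (Suc n) * \<bar>partial_deriv i \<phi> x\<bar>" for x
            using b[of x] by (simp only: real_norm_def abs_mult) (intro mult_right_mono, auto)
        qed
        also have "\<dots> = pi / 2 / real (Suc n) * Q"
          unfolding Q_def by (rule integral_mult_right_zero)
        also have "\<dots> = (pi / 2 * Q) * inverse (real (Suc n))"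
          by (simp only: divide_inverse mult_ac)
        finally show "norm (\<integral>x. F n (f x) * partial_deriv i \<phi> x \<partial>lebesgue_on \<Omega>)
          \<le> (pi / 2 * Q) * inverse (real (Suc n))" .
      qed
      show "(\<lambda>n. (pi / 2 * Q) * inverse (real (Suc n))) \<longlonglongrightarrow> 0"
        using LIMSEQ_inverse_real_of_nat by (rule tendsto_mult_right_zero)
    qed
    have f2: "(\<lambda>n. \<integral>x. F' n (f x) * g x * \<phi> x \<partial>lebesgue_on \<Omega>)
          \<longlonglongrightarrow> (\<integral>x. Z (f x) * g x * \<phi> x \<partial>lebesgue_on \<Omega>)"
    proof (rule integral_dominated_convergence[where w = "\<lambda>x. \<bar>g x * \<phi> x\<bar>"])
      have \<phi>m: "\<phi> \<in> borel_measurable (lebesgue_on \<Omega>)" using test_L2[OF \<phi>] by (rule L2_measurable)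
      show "(\<lambda>x. Z (f x) * g x * \<phi> x) \<in> borel_measurable (lebesgue_on \<Omega>)"
        using Zm L2_measurable[OF g] \<phi>m by measurable
      show "(\<lambda>x. F' n (f x) * g x * \<phi> x) \<in> borel_measurable (lebesgue_on \<Omega>)" for n
        unfolding F'_def using L2_measurable[OF f] L2_measurable[OF g] \<phi>m by measurable
      show "integrable (lebesgue_on \<Omega>) (\<lambda>x. \<bar>g x * \<phi> x\<bar>)"
        using L2_mult_integrable[OF g test_L2[OF \<phi>]] by simp
      have "(\<lambda>n. F' n t) \<longlonglongrightarrow> Z t" for t
      proof (cases "t = 0")
        case False
        have "filterlim (\<lambda>n. real (Suc n)) at_top sequentially"
          by (rule filterlim_compose[OF filterlim_real_sequentially filterlim_Suc])
        then have "filterlim (\<lambda>n. \<bar>t\<bar> * real (Suc n)) at_top sequentially"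
          using False by (intro filterlim_tendsto_pos_mult_at_top[OF tendsto_const]) auto
        then have "filterlim (\<lambda>n. (\<bar>t\<bar> * real (Suc n))\<^sup>2) at_top sequentially"
          by (intro filterlim_pow_at_top) auto
        then have "filterlim (\<lambda>n. 1 + (\<bar>t\<bar> * real (Suc n))\<^sup>2) at_top sequentially"
          by (intro filterlim_tendsto_add_at_top[OF tendsto_const])
        then have "(\<lambda>n. 1 / (1 + (\<bar>t\<bar> * real (Suc n))\<^sup>2)) \<longlonglongrightarrow> 0"
          by (intro tendsto_divide_0[OF tendsto_const] filterlim_at_top_imp_at_infinity)
        then show ?thesis using False by (simp add: F'_def Z_def power_mult_distrib mult.commute)
      qed (simp add: F'_def Z_def)
      then show "AE x in lebesgue_on \<Omega>. (\<lambda>n. F' n (f x) * g x * \<phi> x) \<longlonglongrightarrow> Z (f x) * g x * \<phi> x"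
        by (intro AE_I2 tendsto_mult tendsto_const)
      have "\<bar>F' n t\<bar> \<le> 1" for n t unfolding F'_def by (rule arctan_profile) simp
      then show "AE x in lebesgue_on \<Omega>. norm (F' n (f x) * g x * \<phi> x) \<le> \<bar>g x * \<phi> x\<bar>" for n
        by (intro AE_I2) (simp add: abs_mult mult.assoc mult_left_le_one_le)
    qed
    from LIMSEQ_unique[OF f1[unfolded chain] tendsto_minus[OF f2]]
    show "(\<integral>x. Z (f x) * g x * \<phi> x \<partial>lebesgue_on \<Omega>) = 0" by simp
  qed
  then show ?thesis by eventually_elim (auto simp: Z_def)
qed

end

section \<open>The half-space profile\<close>

context bounded_open_set
begin

lemma is_weak_deriv_Nil: "is_weak_deriv \<Omega> [] u u"
  by (simp add: is_weak_deriv_def)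

lemma is_weak_deriv_first:
  "lipschitz_partial i f g \<Longrightarrow> is_weak_deriv \<Omega> [i] f g"
  by (simp add: is_weak_deriv_def lipschitz_partial_integral)

lemma is_weak_deriv_second:
  "lipschitz_partial i f g \<Longrightarrow> lipschitz_partial j g h \<Longrightarrow> is_weak_deriv \<Omega> [i, j] f h"
  by (simp add: is_weak_deriv_def lipschitz_partial_integral test_partial_deriv)

end

text \<open>
  The exceptional set is the hyperplane \<open>{x\<^sub>k = 0}\<close>, which is a null set; so \<open>p\<close> may have a kink at
  \<open>0\<close>.
\<close>

lemma lipschitz_partial_coordinate:
  fixes p q :: "real \<Rightarrow> real" and i k :: "'n::finite"
  assumes p: "continuous_on UNIV p" and q: "q \<in> borel_measurable borel"
    and lip: "\<And>R. \<exists>L\<ge>0. \<forall>s t. \<bar>s\<bar> \<le> R \<and> \<bar>t\<bar> \<le> 1 \<longrightarrow> \<bar>p (s + t) - p s\<bar> \<le> L * \<bar>t\<bar>"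
    and D: "\<And>s. s \<noteq> 0 \<Longrightarrow> (p has_real_derivative q s) (at s)"
  shows "lipschitz_partial i (\<lambda>x::real^'n. p (x $ k)) (\<lambda>x. if i = k then q (x $ k) else 0)"
  unfolding lipschitz_partial_def
proof (intro conjI allI)
  have coord: "continuous_on UNIV (\<lambda>x::real^'n. x $ k)"
    by (intro continuous_intros)
  show "continuous_on UNIV (\<lambda>x::real^'n. p (x $ k))"
    by (rule continuous_on_compose2[OF p coord]) simp
  have "(\<lambda>x::real^'n. q (x $ k)) \<in> borel_measurable borel"
    using measurable_compose[OF borel_measurable_continuous_onI[OF coord] q] .
  then show "(\<lambda>x::real^'n. if i = k then q (x $ k) else 0) \<in> borel_measurable lebesgue"
    by (intro measurable_completion) auto
  have shift: "(x + t *\<^sub>R axis i 1) $ k = x $ k + (if i = k then t else 0)" for x :: "real^'n" and t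
    by (simp add: axis_def)
  show "\<exists>L. \<forall>x t. norm x \<le> R \<and> \<bar>t\<bar> \<le> 1 \<longrightarrow> \<bar>p ((x + t *\<^sub>R axis i 1) $ k) - p ((x::real^'n) $ k)\<bar> \<le> L * \<bar>t\<bar>" for R
  proof -
    obtain L where L: "0 \<le> L" "\<And>s t. \<bar>s\<bar> \<le> R \<Longrightarrow> \<bar>t\<bar> \<le> 1 \<Longrightarrow> \<bar>p (s + t) - p s\<bar> \<le> L * \<bar>t\<bar>"
      using lip[of R] by blast
    have "\<bar>p ((x + t *\<^sub>R axis i 1) $ k) - p (x $ k)\<bar> \<le> L * \<bar>t\<bar>"
      if "norm x \<le> R" "\<bar>t\<bar> \<le> 1" for x :: "real^'n" and t
    proof -
      have "\<bar>x $ k\<bar> \<le> R" using component_le_norm_cart[of x k] that(1) by linarith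
      then show ?thesis using L that(2) unfolding shift by simp
    qed
    then show ?thesis by blast
  qed
  have "{x::real^'n. x $ k = 0} \<in> null_sets lebesgue"
    using negligible_standard_hyperplane_cart[of k] by (simp add: negligible_iff_null_sets)
  then have "AE x in lebesgue. x \<notin> {x::real^'n. x $ k = 0}" by (rule AE_not_in)
  then show "AE x in lebesgue. ((\<lambda>t. p ((x + t *\<^sub>R axis i 1) $ k)) has_real_derivative
      (if i = k then q ((x::real^'n) $ k) else 0)) (at 0)"
  proof eventually_elim
    case (elim x)
    show ?case
    proof (cases "i = k")
      case True
      have "((\<lambda>t. p (x $ k + t)) has_real_derivative q (x $ k)) (at 0)"
        using D[of "x $ k"] elim DERIV_shift[of p "q (x $ k)" 0 "x $ k"] by (simp add: add.commute)
      then show ?thesis unfolding shift using True by simp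
    next
      case False
      then show ?thesis unfolding shift by simp
    qed
  qed
qed

definition half_quadratic :: "'n::finite \<Rightarrow> real^'n \<Rightarrow> real" where
  "half_quadratic k x = (if x $ k > 0 then (1/2) * (x $ k)\<^sup>2 else 0)"

text \<open>
  All weak derivatives of \<open>half_quadratic k\<close> of order at most \<open>2\<close> in one formula: the profile depends
  only on \<open>x\<^sub>k\<close>, so a derivative is \<open>0\<close> as soon as another index occurs. The value for lists longer
  than \<open>2\<close> is a dummy.
\<close>

definition half_quadratic_deriv :: "'n::finite \<Rightarrow> 'n list \<Rightarrow> real^'n \<Rightarrow> real" where
  "half_quadratic_deriv k \<alpha> x = (if set \<alpha> \<subseteq> {k} then
     (if \<alpha> = [] then half_quadratic k x
      else if length \<alpha> = 1 then max (x $ k) 0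
      else if x $ k > 0 then 1 else 0) else 0)"

lemma half_quadratic_lipschitz_partial:
  "lipschitz_partial i (half_quadratic_deriv k []) (half_quadratic_deriv k [i])"
proof -
  have "lipschitz_partial i (\<lambda>x. (1/2) * (max (x $ k) 0)\<^sup>2) (\<lambda>x. if i = k then max (x $ k) 0 else 0)"
  proof (rule lipschitz_partial_coordinate)
    show "continuous_on UNIV (\<lambda>s::real. 1 / 2 * (max s 0)\<^sup>2)" by (intro continuous_intros)
    show "(\<lambda>s::real. max s 0) \<in> borel_measurable borel" by simp
    show "\<exists>L\<ge>0. \<forall>s t. \<bar>s\<bar> \<le> R \<and> \<bar>t\<bar> \<le> 1 \<longrightarrow>
        \<bar>1 / 2 * (max (s + t) 0)\<^sup>2 - 1 / 2 * (max s 0)\<^sup>2\<bar> \<le> L * \<bar>t\<bar>" for R :: real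
    proof (intro exI[of _ "\<bar>R\<bar> + 1"] conjI allI impI)
      fix s t :: real assume st: "\<bar>s\<bar> \<le> R \<and> \<bar>t\<bar> \<le> 1"
      have "\<bar>1 / 2 * (max (s + t) 0)\<^sup>2 - 1 / 2 * (max s 0)\<^sup>2\<bar>
          = \<bar>(max (s + t) 0 + max s 0) / 2\<bar> * \<bar>max (s + t) 0 - max s 0\<bar>"
        unfolding abs_mult[symmetric] by (rule arg_cong[where f = abs]) (simp add: power2_eq_square field_simps)
      also have "\<dots> \<le> (\<bar>R\<bar> + 1) * \<bar>t\<bar>"
        using st by (intro mult_mono) auto
      finally show "\<bar>1 / 2 * (max (s + t) 0)\<^sup>2 - 1 / 2 * (max s 0)\<^sup>2\<bar> \<le> (\<bar>R\<bar> + 1) * \<bar>t\<bar>" .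
    qed simp
    fix s :: real assume "s \<noteq> 0"
    then consider "s > 0" | "s < 0" by linarith
    then show "((\<lambda>s. 1 / 2 * (max s 0)\<^sup>2) has_real_derivative max s 0) (at s)"
    proof cases
      case 1
      have "((\<lambda>s. 1 / 2 * s\<^sup>2) has_real_derivative s) (at s)"
        by (auto intro!: derivative_eq_intros)
      then have "((\<lambda>s. 1 / 2 * (max s 0)\<^sup>2) has_real_derivative s) (at s)"
        by (rule has_field_derivative_transform_within_open[where S = "{0<..}"]) (use 1 in auto)
      then show ?thesis using 1 by simp
    next
      case 2
      have "((\<lambda>_. 0) has_real_derivative 0) (at s)" by simp
      then have "((\<lambda>s. 1 / 2 * (max s 0)\<^sup>2) has_real_derivative 0) (at s)"
        by (rule has_field_derivative_transform_within_open[where S = "{..<0}"]) (use 2 in auto)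
      then show ?thesis using 2 by simp
    qed
  qed
  moreover have "half_quadratic_deriv k [] = (\<lambda>x. (1/2) * (max (x $ k) 0)\<^sup>2)"
    by (auto simp: half_quadratic_deriv_def half_quadratic_def fun_eq_iff max_def)
  moreover have "half_quadratic_deriv k [i] = (\<lambda>x. if i = k then max (x $ k) 0 else 0)"
    by (auto simp: half_quadratic_deriv_def fun_eq_iff)
  ultimately show ?thesis by simp
qed

lemma half_quadratic_deriv_lipschitz_partial:
  "lipschitz_partial j (half_quadratic_deriv k [i]) (half_quadratic_deriv k [i, j])"
proof (cases "i = k")
  case True
  have "lipschitz_partial j (\<lambda>x. max (x $ k) 0) (\<lambda>x. if j = k then (if x $ k > 0 then 1 else 0) else 0)"
  proof (rule lipschitz_partial_coordinate)
    show "continuous_on UNIV (\<lambda>s::real. max s 0)" by (intro continuous_intros)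
    show "(\<lambda>s::real. if 0 < s then 1 else 0 :: real) \<in> borel_measurable borel" by simp
    show "\<exists>L\<ge>0. \<forall>s t. \<bar>s\<bar> \<le> R \<and> \<bar>t\<bar> \<le> 1 \<longrightarrow> \<bar>max (s + t) 0 - max s 0\<bar> \<le> L * \<bar>t\<bar>" for R :: real
      by (intro exI[of _ 1]) auto
    fix s :: real assume "s \<noteq> 0"
    then consider "s > 0" | "s < 0" by linarith
    then show "((\<lambda>s. max s 0) has_real_derivative (if 0 < s then 1 else 0)) (at s)"
    proof cases
      case 1
      have "((\<lambda>s. s) has_real_derivative 1) (at s)" by simp
      then have "((\<lambda>s. max s 0) has_real_derivative 1) (at s)"
        by (rule has_field_derivative_transform_within_open[where S = "{0<..}"]) (use 1 in auto)
      then show ?thesis using 1 by simp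
    next
      case 2
      have "((\<lambda>_. 0) has_real_derivative 0) (at s)" by simp
      then have "((\<lambda>s. max s 0) has_real_derivative 0) (at s)"
        by (rule has_field_derivative_transform_within_open[where S = "{..<0}"]) (use 2 in auto)
      then show ?thesis using 2 by simp
    qed
  qed
  moreover have "half_quadratic_deriv k [i] = (\<lambda>x. max (x $ k) 0)"
    using True by (auto simp: half_quadratic_deriv_def fun_eq_iff)
  moreover have "half_quadratic_deriv k [i, j] = (\<lambda>x. if j = k then (if x $ k > 0 then 1 else 0) else 0)"
    using True by (auto simp: half_quadratic_deriv_def fun_eq_iff)
  ultimately show ?thesis by simp
next
  case False
  then have "half_quadratic_deriv k [i] = (\<lambda>_. 0)" "half_quadratic_deriv k [i, j] = (\<lambda>_. 0)"
    by (auto simp: half_quadratic_deriv_def fun_eq_iff)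
  then show ?thesis
    by (auto simp: lipschitz_partial_def intro!: exI[of _ 0])
qed

context bounded_open_set
begin

lemma half_quadratic_deriv_L2: "half_quadratic_deriv k \<alpha> \<in> L2_space \<Omega>"
proof -
  obtain R where R: "\<And>x. x \<in> \<Omega> \<Longrightarrow> norm x \<le> R" using bounded_\<Omega> by (auto simp: bounded_iff)
  \<comment> \<open>The three summands of the bound \<open>1 + \<bar>R\<bar> + R\<^sup>2\<close> cover the orders \<open>2\<close>, \<open>1\<close> and \<open>0\<close>.\<close>
  define c where "c = R\<^sup>2"
  have "0 \<le> c" by (simp add: c_def)
  show ?thesis
  proof (rule L2_bounded[where B = "1 + \<bar>R\<bar> + c"])
    have "(\<lambda>x::real^'n. x $ k) \<in> borel_measurable borel"
      by (intro borel_measurable_continuous_onI continuous_intros)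
    then have "half_quadratic_deriv k \<alpha> \<in> borel_measurable borel"
      unfolding half_quadratic_deriv_def half_quadratic_def by measurable
    then show "half_quadratic_deriv k \<alpha> \<in> borel_measurable (lebesgue_on \<Omega>)"
      by (simp add: measurable_completion measurable_restrict_space1)
    fix x assume "x \<in> \<Omega>"
    then have "\<bar>x $ k\<bar> \<le> \<bar>R\<bar>" using component_le_norm_cart[of x k] R[of x] by linarith
    moreover from this have "(x $ k)\<^sup>2 \<le> c" by (simp add: c_def abs_le_square_iff)
    ultimately show "\<bar>half_quadratic_deriv k \<alpha> x\<bar> \<le> 1 + \<bar>R\<bar> + c"
      using \<open>0 \<le> c\<close> by (auto simp: half_quadratic_deriv_def half_quadratic_def max_def)
  qed
qed

lemma half_quadratic_weak_deriv:
  assumes "length \<alpha> \<le> 2"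
  shows "is_weak_deriv \<Omega> \<alpha> (half_quadratic k) (half_quadratic_deriv k \<alpha>)"
proof -
  have nil: "half_quadratic_deriv k [] = half_quadratic k"
    by (simp add: half_quadratic_deriv_def fun_eq_iff)
  consider "\<alpha> = []" | i where "\<alpha> = [i]" | i j where "\<alpha> = [i, j]"
    using assms by (cases \<alpha>; cases "tl \<alpha>"; cases "tl (tl \<alpha>)") auto
  then show ?thesis
  proof cases
    case 1
    then show ?thesis by (simp add: nil is_weak_deriv_Nil)
  next
    case 2
    then show ?thesis
      using is_weak_deriv_first[OF half_quadratic_lipschitz_partial[of i k]] by (simp add: nil)
  next
    case 3
    then show ?thesis
      using is_weak_deriv_second[OF half_quadratic_lipschitz_partial[of i k]
          half_quadratic_deriv_lipschitz_partial[of j k i]]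
      by (simp add: nil)
  qed
qed

lemma half_quadratic_sobolev: "half_quadratic k \<in> sobolev_H 2 \<Omega>"
  using half_quadratic_deriv_L2[of k "[]"] half_quadratic_deriv_L2[of k] half_quadratic_weak_deriv[of _ k]
  unfolding sobolev_H_def
  by (auto simp: half_quadratic_deriv_def[of k "[]", abs_def])

text \<open>
  Restricting to repeated indices avoids the symmetry of second derivatives: integrating by parts
  twice produces the derivatives in reversed order.
\<close>

lemma test_weak_deriv:
  assumes \<phi>: "\<phi> \<in> test_functions \<Omega>" and \<alpha>: "\<alpha> = [] \<or> \<alpha> = [i] \<or> \<alpha> = [i, i]"
  shows "is_weak_deriv \<Omega> \<alpha> \<phi> (iter_partial \<alpha> \<phi>)"
  using \<alpha> is_weak_deriv_Nil is_weak_deriv_first[OF test_lipschitz_partial[OF \<phi>]]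
    is_weak_deriv_second[OF test_lipschitz_partial[OF \<phi>] test_lipschitz_partial[OF test_partial_deriv[OF \<phi>]]]
  by auto

lemma L2_norm_weak_deriv_le:
  assumes "length \<alpha> \<le> m"
  shows "L2_norm (weak_deriv \<Omega> \<alpha> u) \<le> sobolev_norm m \<Omega> u"
  unfolding L2_norm_def sobolev_norm_def
proof (rule real_sqrt_le_mono, rule member_le_sum)
  have "finite {\<alpha>. set \<alpha> \<subseteq> (UNIV :: 'n set) \<and> length \<alpha> \<le> m}"
    by (rule finite_lists_length_le) simp
  then show "finite {\<alpha> :: 'n list. length \<alpha> \<le> m}" by simp
qed (use assms in simp_all)

section \<open>Minimality\<close>

lemma nonzero_set_measure:
  fixes h :: "real^'n \<Rightarrow> real"
  assumes h: "h \<in> borel_measurable (lebesgue_on \<Omega>)"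
  shows "measure lebesgue {x \<in> \<Omega>. h x \<noteq> 0} = (\<integral>x. (if h x \<noteq> 0 then 1 else 0) \<partial>lebesgue_on \<Omega>)"
    and "integrable (lebesgue_on \<Omega>) (\<lambda>x. if h x \<noteq> 0 then 1 else 0 :: real)"
proof -
  have A: "{x \<in> \<Omega>. h x \<noteq> 0} \<in> sets (lebesgue_on \<Omega>)"
    using borel_measurable_neq[OF h borel_measurable_const[of 0]] by simp
  have "measure lebesgue {x \<in> \<Omega>. h x \<noteq> 0} = measure (lebesgue_on \<Omega>) {x \<in> \<Omega>. h x \<noteq> 0}"
    by (rule measure_restrict_space[symmetric]) auto
  also have "\<dots> = (\<integral>x. indicator {x \<in> \<Omega>. h x \<noteq> 0} x \<partial>lebesgue_on \<Omega>)"
    using A by (simp add: Int_absorb2 sets.sets_into_space)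
  also have "\<dots> = (\<integral>x. (if h x \<noteq> 0 then 1 else 0) \<partial>lebesgue_on \<Omega>)"
    by (intro Bochner_Integration.integral_cong) (auto simp: indicator_def)
  finally show "measure lebesgue {x \<in> \<Omega>. h x \<noteq> 0} = (\<integral>x. (if h x \<noteq> 0 then 1 else 0) \<partial>lebesgue_on \<Omega>)" .
  have "integrable (lebesgue_on \<Omega>) (indicator {x \<in> \<Omega>. h x \<noteq> 0} :: _ \<Rightarrow> real)"
    using A by (intro integrable_bounded[where B = 1]) (auto simp: indicator_def)
  also have "?this \<longleftrightarrow> integrable (lebesgue_on \<Omega>) (\<lambda>x. if h x \<noteq> 0 then 1 else 0 :: real)"
    by (intro Bochner_Integration.integrable_cong) (auto simp: indicator_def)
  finally show "integrable (lebesgue_on \<Omega>) (\<lambda>x. if h x \<noteq> 0 then 1 else 0 :: real)" .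
qed

lemma sum_half_quadratic_deriv:
  "(\<Sum>i\<in>UNIV. half_quadratic_deriv k [i, i] x) = (if x $ k > 0 then 1 else 0)"
proof -
  have "(\<Sum>i\<in>UNIV. half_quadratic_deriv k [i, i] x)
      = (\<Sum>i\<in>UNIV. if i = k then (if x $ k > 0 then 1 else 0) else 0)"
    by (intro sum.cong) (auto simp: half_quadratic_deriv_def)
  then show ?thesis by simp
qed

text \<open>
  The Laplacian of the profile and the indicator of its support are the same function, and this
  function equals its square.
\<close>

lemma biharmonic_AC_half_quadratic:
  "biharmonic_AC (half_quadratic k) \<Omega> = 2 * (\<integral>x. (if x $ k > 0 then 1 else 0) \<partial>lebesgue_on \<Omega>)"
proof -
  define U where "U = half_quadratic_deriv k"
  define S where "S x = (if x $ k > 0 then 1 else 0 :: real)" for x :: "real^'n"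
  have U: "U \<alpha> \<in> L2_space \<Omega>" for \<alpha> unfolding U_def by (rule half_quadratic_deriv_L2)
  have uL2: "half_quadratic k \<in> L2_space \<Omega>"
    using sobolev_L2 half_quadratic_sobolev by blast
  have sumU: "(\<Sum>i\<in>UNIV. U [i, i] x) = S x" for x
    unfolding U_def S_def by (rule sum_half_quadratic_deriv)
  have Sint: "integrable (lebesgue_on \<Omega>) S"
    using Bochner_Integration.integrable_sum[of UNIV "lebesgue_on \<Omega>" "\<lambda>i. U [i, i]"] L2_integrable[OF U]
    by (simp add: sumU)
  have "AE x in lebesgue_on \<Omega>. \<forall>i. weak_deriv \<Omega> [i, i] (half_quadratic k) x = U [i, i] x"
    unfolding AE_all_countable
    using weak_deriv_works(3)[OF U half_quadratic_weak_deriv[of "[_, _]" k, folded U_def]] by simp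
  then have lap: "AE x in lebesgue_on \<Omega>. (weak_laplacian \<Omega> (half_quadratic k) x)\<^sup>2 = S x"
    by eventually_elim (simp add: weak_laplacian_def sumU, simp add: S_def)
  have "weak_laplacian \<Omega> (half_quadratic k) \<in> L2_space \<Omega>"
    unfolding weak_laplacian_def[abs_def]
    using sobolev_weak_deriv(1)[OF half_quadratic_sobolev] by (intro L2_sum) simp
  then have "(\<integral>x. (weak_laplacian \<Omega> (half_quadratic k) x)\<^sup>2 \<partial>lebesgue_on \<Omega>) = (\<integral>x. S x \<partial>lebesgue_on \<Omega>)"
    using lap Sint by (intro integral_cong_AE) (auto simp: L2_space_def)
  moreover have "measure lebesgue {x \<in> \<Omega>. half_quadratic k x \<noteq> 0} = (\<integral>x. S x \<partial>lebesgue_on \<Omega>)"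
    unfolding nonzero_set_measure(1)[OF L2_measurable[OF uL2]]
    by (intro Bochner_Integration.integral_cong) (auto simp: S_def half_quadratic_def)
  ultimately show ?thesis by (simp add: biharmonic_AC_def S_def)
qed

text \<open>
  Integrating \<open>2 \<Delta> v \<le> (\<Delta> v)\<^sup>2 + 1\<^bsub>{v \<noteq> 0}\<^esub>\<close> bounds the energy of \<open>v\<close> from below by \<open>2 \<integral> \<Delta> v\<close>,
  which depends only on the boundary data and so equals \<open>2 \<integral> \<Delta> u\<close>, the energy of the profile.
\<close>

proposition half_quadratic_minimal:
  assumes v: "v \<in> sobolev_H 2 \<Omega>" and w: "(\<lambda>x. v x - half_quadratic k x) \<in> sobolev_H0 2 \<Omega>"
  shows "biharmonic_AC (half_quadratic k) \<Omega> \<le> biharmonic_AC v \<Omega>"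
proof -
  define U where "U = half_quadratic_deriv k"
  define V where "V \<alpha> = weak_deriv \<Omega> \<alpha> v" for \<alpha>
  have U: "U \<alpha> \<in> L2_space \<Omega>" for \<alpha> unfolding U_def by (rule half_quadratic_deriv_L2)
  have V: "V \<alpha> \<in> L2_space \<Omega>" "is_weak_deriv \<Omega> \<alpha> v (V \<alpha>)" if "length \<alpha> \<le> 2" for \<alpha>
    unfolding V_def using sobolev_weak_deriv[OF v that] by auto
  have vL2: "v \<in> L2_space \<Omega>" and uL2: "half_quadratic k \<in> L2_space \<Omega>"
    using sobolev_L2 v half_quadratic_sobolev by blast+
  \<comment> \<open>Up to a null set \<open>V \<alpha> - U \<alpha> - \<partial>\<^sup>\<alpha> \<phi>\<close> is the chosen weak derivative of \<open>v - u - \<phi>\<close>, so its \<open>L\<^sup>2\<close>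
    norm is bounded by the Sobolev norm of that function, which is small for suitable \<open>\<phi>\<close>.\<close>
  have approx: "\<exists>\<phi>\<in>test_functions \<Omega>. \<forall>\<alpha> i. \<alpha> = [] \<or> \<alpha> = [i] \<or> \<alpha> = [i, i] \<longrightarrow>
      L2_norm (\<lambda>x. V \<alpha> x - (U \<alpha> x + iter_partial \<alpha> \<phi> x)) < \<epsilon>" if "\<epsilon> > 0" for \<epsilon>
  proof -
    have "\<exists>\<phi>\<in>test_functions \<Omega>. sobolev_norm 2 \<Omega> (\<lambda>x. v x - half_quadratic k x - \<phi> x) < \<epsilon>"
      using w that by (simp add: sobolev_H0_def)
    then obtain \<phi> where \<phi>: "\<phi> \<in> test_functions \<Omega>"
      and less: "sobolev_norm 2 \<Omega> (\<lambda>x. v x - half_quadratic k x - \<phi> x) < \<epsilon>"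
      by blast
    have "L2_norm (\<lambda>x. V \<alpha> x - (U \<alpha> x + iter_partial \<alpha> \<phi> x)) < \<epsilon>"
      if \<alpha>: "\<alpha> = [] \<or> \<alpha> = [i] \<or> \<alpha> = [i, i]" for \<alpha> i
    proof -
      have len: "length \<alpha> \<le> 2" using \<alpha> by auto
      have \<phi>2: "\<phi> \<in> L2_space \<Omega>" "iter_partial \<alpha> \<phi> \<in> L2_space \<Omega>"
        using \<phi> by (auto intro: test_L2 test_iter_partial)
      have wd: "is_weak_deriv \<Omega> \<alpha> (\<lambda>x. v x - half_quadratic k x - \<phi> x)
          (\<lambda>x. V \<alpha> x - U \<alpha> x - iter_partial \<alpha> \<phi> x)"
        using V[OF len] U \<phi>2 vL2 uL2 half_quadratic_weak_deriv[OF len] test_weak_deriv[OF \<phi> \<alpha>]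
        unfolding U_def by (intro is_weak_deriv_diff L2_diff)
      have L2: "(\<lambda>x. V \<alpha> x - U \<alpha> x - iter_partial \<alpha> \<phi> x) \<in> L2_space \<Omega>"
        using V[OF len] U \<phi>2 by (intro L2_diff)
      have "L2_norm (\<lambda>x. V \<alpha> x - U \<alpha> x - iter_partial \<alpha> \<phi> x)
          = L2_norm (weak_deriv \<Omega> \<alpha> (\<lambda>x. v x - half_quadratic k x - \<phi> x))"
        by (rule L2_norm_cong_AE[OF weak_deriv_works(1)[OF L2 wd] L2 weak_deriv_works(3)[OF L2 wd], symmetric])
      also have "\<dots> \<le> sobolev_norm 2 \<Omega> (\<lambda>x. v x - half_quadratic k x - \<phi> x)"
        by (rule L2_norm_weak_deriv_le[OF len])
      finally show ?thesis using less by (simp add: algebra_simps)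
    qed
    then show ?thesis using \<phi> by blast
  qed
  have L2sum: "(\<lambda>x. U \<alpha> x + iter_partial \<alpha> \<phi> x) \<in> L2_space \<Omega>" if "\<phi> \<in> test_functions \<Omega>" for \<alpha> \<phi>
    by (rule L2_add[OF U test_L2[OF test_iter_partial[OF that]]])
  have pair1: "approximable_pair i (V []) (V [i])" for i
    unfolding approximable_pair_def
  proof (intro conjI allI impI)
    fix \<epsilon> :: real assume "\<epsilon> > 0"
    from approx[OF this] obtain \<phi> where \<phi>: "\<phi> \<in> test_functions \<Omega>"
      and less: "\<forall>\<alpha> i. \<alpha> = [] \<or> \<alpha> = [i] \<or> \<alpha> = [i, i] \<longrightarrow>
        L2_norm (\<lambda>x. V \<alpha> x - (U \<alpha> x + iter_partial \<alpha> \<phi> x)) < \<epsilon>" ..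
    have "lipschitz_partial i (\<lambda>x. U [] x + iter_partial [] \<phi> x) (\<lambda>x. U [i] x + iter_partial [i] \<phi> x)"
      unfolding U_def iter_partial_simps
      by (intro lipschitz_partial_add half_quadratic_lipschitz_partial test_lipschitz_partial[OF \<phi>])
    then show "\<exists>a b. lipschitz_partial i a b \<and> a \<in> L2_space \<Omega> \<and> b \<in> L2_space \<Omega> \<and>
        L2_norm (\<lambda>x. V [] x - a x) < \<epsilon> \<and> L2_norm (\<lambda>x. V [i] x - b x) < \<epsilon>"
      using less[rule_format, of "[]" i] less[rule_format, of "[i]" i]
        L2sum[OF \<phi>, of "[]"] L2sum[OF \<phi>, of "[i]"]
      by (intro exI conjI) simp_all
  qed (simp_all add: V)
  have pair2: "approximable_pair i (V [i]) (V [i, i])" for i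
    unfolding approximable_pair_def
  proof (intro conjI allI impI)
    fix \<epsilon> :: real assume "\<epsilon> > 0"
    from approx[OF this] obtain \<phi> where \<phi>: "\<phi> \<in> test_functions \<Omega>"
      and less: "\<forall>\<alpha> i. \<alpha> = [] \<or> \<alpha> = [i] \<or> \<alpha> = [i, i] \<longrightarrow>
        L2_norm (\<lambda>x. V \<alpha> x - (U \<alpha> x + iter_partial \<alpha> \<phi> x)) < \<epsilon>" ..
    have "lipschitz_partial i (\<lambda>x. U [i] x + iter_partial [i] \<phi> x) (\<lambda>x. U [i, i] x + iter_partial [i, i] \<phi> x)"
      unfolding U_def iter_partial_simps
      by (intro lipschitz_partial_add half_quadratic_deriv_lipschitz_partial
          test_lipschitz_partial[OF test_partial_deriv[OF \<phi>]])
    then show "\<exists>a b. lipschitz_partial i a b \<and> a \<in> L2_space \<Omega> \<and> b \<in> L2_space \<Omega> \<and>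
        L2_norm (\<lambda>x. V [i] x - a x) < \<epsilon> \<and> L2_norm (\<lambda>x. V [i, i] x - b x) < \<epsilon>"
      using less[rule_format, of "[i]" i] less[rule_format, of "[i, i]" i]
        L2sum[OF \<phi>, of "[i]"] L2sum[OF \<phi>, of "[i, i]"]
      by (intro exI conjI) simp_all
  qed (simp_all add: V)
  \<comment> \<open>The derivative of order \<open>0\<close> is also a chosen one, so it equals \<open>v\<close> only almost everywhere.\<close>
  have V0: "AE x in lebesgue_on \<Omega>. V [] x = v x"
    using weak_deriv_works(3)[OF vL2 is_weak_deriv_Nil] by (simp add: V_def)
  have "AE x in lebesgue_on \<Omega>. v x = 0 \<longrightarrow> V [i, i] x = 0" for i
    using derivative_zero_on_zero_set[OF pair1[of i]] derivative_zero_on_zero_set[OF pair2[of i]] V0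
    by eventually_elim auto
  then have "AE x in lebesgue_on \<Omega>. \<forall>i. v x = 0 \<longrightarrow> V [i, i] x = 0"
    unfolding AE_all_countable by blast
  then have lap0: "AE x in lebesgue_on \<Omega>. v x = 0 \<longrightarrow> weak_laplacian \<Omega> v x = 0"
    by eventually_elim (simp add: weak_laplacian_def V_def)

  have same_integral: "(\<integral>x. V [i, i] x \<partial>lebesgue_on \<Omega>) = (\<integral>x. U [i, i] x \<partial>lebesgue_on \<Omega>)" for i
  proof -
    define d where "d = (\<integral>x. V [i, i] x \<partial>lebesgue_on \<Omega>) - (\<integral>x. U [i, i] x \<partial>lebesgue_on \<Omega>)"
    define N where "N = L2_norm (\<lambda>_. 1)"
    have one: "(\<lambda>_. 1) \<in> L2_space \<Omega>" by (rule L2_bounded[where B = 1]) auto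
    have "0 \<le> N" by (simp add: N_def L2_norm_nonneg)
    have bound: "\<bar>d\<bar> \<le> \<epsilon> * N" if \<epsilon>: "\<epsilon> > 0" for \<epsilon>
    proof -
      from approx[OF \<epsilon>] obtain \<phi> where \<phi>: "\<phi> \<in> test_functions \<Omega>"
        and "\<forall>\<alpha> i. \<alpha> = [] \<or> \<alpha> = [i] \<or> \<alpha> = [i, i] \<longrightarrow>
          L2_norm (\<lambda>x. V \<alpha> x - (U \<alpha> x + iter_partial \<alpha> \<phi> x)) < \<epsilon>" ..
      then have less: "L2_norm (\<lambda>x. V [i, i] x - (U [i, i] x + iter_partial [i, i] \<phi> x)) < \<epsilon>"
        by (simp del: iter_partial_simps)
      \<comment> \<open>Integrating by parts against the constant \<open>1\<close> shows that \<open>\<partial>\<^sub>i\<partial>\<^sub>i \<phi>\<close> has integral \<open>0\<close>.\<close>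
      have "lipschitz_partial i (\<lambda>_::real^'n. 1) (\<lambda>_. 0)"
        by (auto simp: lipschitz_partial_def intro!: exI[of _ 0])
      from lipschitz_partial_integral[OF this test_partial_deriv[OF \<phi>, of i]]
      have "(\<integral>x. iter_partial [i, i] \<phi> x \<partial>lebesgue_on \<Omega>) = 0" by simp
      moreover have "integrable (lebesgue_on \<Omega>) (iter_partial [i, i] \<phi>)"
        using \<phi> by (intro L2_integrable test_L2 test_iter_partial)
      ultimately have "d = (\<integral>x. V [i, i] x - (U [i, i] x + iter_partial [i, i] \<phi> x) \<partial>lebesgue_on \<Omega>)"
        using L2_integrable[OF U] L2_integrable[OF V(1)] by (simp add: d_def del: iter_partial_simps)
      also have "\<bar>\<dots>\<bar> \<le> L2_norm (\<lambda>x. V [i, i] x - (U [i, i] x + iter_partial [i, i] \<phi> x)) * N"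
        unfolding N_def
        by (rule integral_mult_le_L2[OF L2_integrable _ one])
          (auto simp: V L2sum[OF \<phi>] simp del: iter_partial_simps intro!: L2_diff)
      also have "\<dots> \<le> \<epsilon> * N" using less \<open>0 \<le> N\<close> by (intro mult_right_mono) auto
      finally show ?thesis .
    qed
    have "d = 0" by (rule eq_0_if_arbitrarily_small[OF \<open>0 \<le> N\<close> bound])
    then show ?thesis by (simp add: d_def)
  qed
  have lapL2: "weak_laplacian \<Omega> v \<in> L2_space \<Omega>"
    unfolding weak_laplacian_def[abs_def] using V(1) by (intro L2_sum) (simp add: V_def)
  have lap_int: "(\<integral>x. weak_laplacian \<Omega> v x \<partial>lebesgue_on \<Omega>) = (\<integral>x. (if x $ k > 0 then 1 else 0) \<partial>lebesgue_on \<Omega>)"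
  proof -
    have "(\<integral>x. weak_laplacian \<Omega> v x \<partial>lebesgue_on \<Omega>) = (\<Sum>i\<in>UNIV. \<integral>x. V [i, i] x \<partial>lebesgue_on \<Omega>)"
      unfolding weak_laplacian_def V_def[symmetric]
      by (intro Bochner_Integration.integral_sum L2_integrable V) simp
    also have "\<dots> = (\<integral>x. (\<Sum>i\<in>UNIV. U [i, i] x) \<partial>lebesgue_on \<Omega>)"
      unfolding same_integral by (intro Bochner_Integration.integral_sum[symmetric] L2_integrable U)
    finally show ?thesis by (simp only: U_def sum_half_quadratic_deriv)
  qed
  have "biharmonic_AC (half_quadratic k) \<Omega> = (\<integral>x. 2 * weak_laplacian \<Omega> v x \<partial>lebesgue_on \<Omega>)"
    by (simp add: biharmonic_AC_half_quadratic lap_int)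
  also have "\<dots> \<le> (\<integral>x. (weak_laplacian \<Omega> v x)\<^sup>2 + (if v x \<noteq> 0 then 1 else 0) \<partial>lebesgue_on \<Omega>)"
  proof (rule integral_mono_AE)
    show "integrable (lebesgue_on \<Omega>) (\<lambda>x. 2 * weak_laplacian \<Omega> v x)"
      using L2_integrable[OF lapL2] by simp
    show "integrable (lebesgue_on \<Omega>) (\<lambda>x. (weak_laplacian \<Omega> v x)\<^sup>2 + (if v x \<noteq> 0 then 1 else 0))"
      using lapL2 nonzero_set_measure(2)[OF L2_measurable[OF vL2]] by (simp add: L2_space_def)
    show "AE x in lebesgue_on \<Omega>. 2 * weak_laplacian \<Omega> v x \<le> (weak_laplacian \<Omega> v x)\<^sup>2 + (if v x \<noteq> 0 then 1 else 0)"
      using lap0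
    proof eventually_elim
      case (elim x)
      have "0 \<le> (weak_laplacian \<Omega> v x - 1)\<^sup>2" by simp
      then show ?case using elim by (auto simp: power2_diff)
    qed
  qed
  also have "\<dots> = biharmonic_AC v \<Omega>"
    using lapL2 nonzero_set_measure(2)[OF L2_measurable[OF vL2]]
    unfolding biharmonic_AC_def nonzero_set_measure(1)[OF L2_measurable[OF vL2]]
    by (intro Bochner_Integration.integral_add) (simp_all add: L2_space_def)
  finally show ?thesis .
qed

end

theorem theorem1:
  fixes k :: "'n::finite"
  shows "global_minimizer (\<lambda>x::real^'n. if x $ k > 0 then (1/2) * (x $ k)\<^sup>2 else 0)"
proof -
  have "half_quadratic k \<in> sobolev_H 2 \<Omega>" if "open \<Omega>" "bounded \<Omega>" for \<Omega>
    using that by (intro bounded_open_set.half_quadratic_sobolev bounded_open_set.intro)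
  moreover have "biharmonic_AC (half_quadratic k) \<Omega> \<le> biharmonic_AC v \<Omega>"
    if "open \<Omega>" "bounded \<Omega>" "v \<in> sobolev_H 2 \<Omega>" "(\<lambda>x. v x - half_quadratic k x) \<in> sobolev_H0 2 \<Omega>" for \<Omega> v
    using that by (intro bounded_open_set.half_quadratic_minimal bounded_open_set.intro)
  ultimately have "global_minimizer (half_quadratic k)"
    unfolding global_minimizer_def sobolev_H_loc_def by blast
  then show ?thesis by (simp only: half_quadratic_def[abs_def])
qed

end
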